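(* Let $X$ and $X'$ be locally standard $T^m$-pseudomanifolds over graphs, with characteristic data $(Q,\lambda,0)$ and $(Q',\lambda',0)$. Then $(Q,\lambda,0)$ and $(Q',\lambda',0)$ are isomorphic (resp. weakly isomorphic) if and only if $X$ and $X'$ are $T^m$-equivariantly homeomorphic (resp. weakly $T^m$-equivariantly homeomorphic, i.e. homeomorphic via $F$ with $F(tx)=\psi(t)F(x)$ for some automorphism $\psi$ of $T^m$).
   Context: Notation: $U(1)=\{z\in\mathbb C:|z|=1\}$, $T^m=U(1)^m$, $\mathbb C^\times=\mathbb C\setminus\{0\}$, open cone $\mathring c(L)=L\times[0,1)/(L\times\{0\})$ ($\mathring c(\emptyset)$ a point). A topological stratified pseudomanifold is a Hausdorff space $Q$ with closed filtration $Q=Q_{l+n}\supsetneq\cdots\supsetneq Q_l\supsetneq\emptyset$ whose strata (components of $Q_i\setminus Q_{i-1}$) are $i$-manifolds, with $\mathring Q=Q_{l+n}\setminus Q_{l+n-1}$ dense, and each point $p$ of an $(l+i)$-stratum having a filtration-preserving neighborhood $O\times\mathring c(L_p)$, $O\subset\mathbb R^{l+i}$ contractible open, $L_p$ a compact $(n-i-1)$-dimensional topological stratified pseudomanifold (the link). Locally standard $T^m$-pseudomanifold $X$ (dimension $l+m+n$, $l\ge0$, $m\ge n\ge0$): a second-countable compact Hausdorff space with effective continuous $T^m$-action with subtorus isotropy groups, filtered by $X_{l+2i+(m-n)}=X_{l+2i+1+(m-n)}=\{x:\dim T^mx\le i+m-n\}$ ($0\le i\le n$), which is a topological stratified pseudomanifold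 with no orbits of dimension $<m-n$ and with free orbits if $l+n\ne0$, and inductively: if $l+n=0$, $X$ is a finite disjoint union of copies of $T^m$; otherwise each $x\in X_{l+2i+(m-n)}\setminus X_{l+2(i-1)+(m-n)}$ has an invariant open neighborhood weakly equivariantly homeomorphic to $O\times(\Omega\times U(1)^{m-n})\times\mathring c(L_x)$ with $O\subset\mathbb R^l$ contractible open, $\Omega\subset(\mathbb C^\times)^i$ invariant open, $L_x$ a compact $(2n-2i-1)$-dimensional locally standard $T_x$-pseudomanifold ($T_x\cong T^{n-i}$ the isotropy group), $T^m\cong U(1)^{i+m-n}\times T_x$ acting freely on the middle factor and via $L_x$ on the cone. The orbit space $Q=X/T^m$ with filtration $Q_{l+i}=X_{l+2i+(m-n)}/T^m$ is a topological stratified pseudomanifold of dimension $l+n$. When $l=0,n=1$, $Q$ is a finite graph and $X$ is called a locally standard $T^m$-pseudomanifold over a graph. Characteristic functor: $\lambda(S)$ is the common isotropy group of points over the stratum $S$. $\mathring X=X\setminus X_{l+m+n-2}$ consists of free orbits and $\mathring X\to\mathring Q$ is a principal $T^m$-bundle; its Chern class is $c^{\mathrm{free}}\in H^2(\mathring Q;\mathbb Z^m)$ (for $X$ over a graph, $c^{\mathrm{free}}=0$). The characteristic data of $X$ is $(Q,\lambda,c^{\mathrm{free}})$. A weak isomorphism $(Q,\lambda,c^{\mathrm{free}})\to(Q',\lambda',c'^{\mathrm{free}})$ is a stratified homeomorphism $f:Q\to Q'$ (a homeomorphism carrying strata onto strata and preserving the filtration) such that $(f|_{\mathring Q})^*(c'^{\mathrm{free}})=c^{\mathrm{free}}$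 and there is an automorphism $\psi$ of $T^m$ with $\psi(\lambda(S))=\lambda'(f(S))$ for all strata $S$; it is an isomorphism if $\psi=\mathrm{id}$. *)

theory Defs
  imports "HOL-Analysis.Analysis"
begin

text \<open>T^m is modelled as the set of vectors in complex^'m all of whose coordinates
have modulus one; the dimension m is CARD('m) (so m >= 1 automatically).
The group law is componentwise multiplication.\<close>

definition torus :: "(complex ^ 'm) set" where
  "torus = {t. \<forall>i. norm (t $ i) = 1}"

definition torus_aut :: "(complex ^ 'm \<Rightarrow> complex ^ 'm) \<Rightarrow> bool" where
  "torus_aut \<phi> \<longleftrightarrow>
     (\<exists>\<psi>. homeomorphism torus torus \<phi> \<psi>) \<and>
     (\<forall>s\<in>torus. \<forall>t\<in>torus. \<phi> (s * t) = \<phi> s * \<phi> t)"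

definition subtorus :: "(complex ^ 'm) set \<Rightarrow> bool" where
  "subtorus H \<longleftrightarrow> H \<subseteq> torus \<and> 1 \<in> H \<and>
     (\<forall>s\<in>H. \<forall>t\<in>H. s * t \<in> H) \<and> (\<forall>t\<in>H. (\<chi> j. inverse (t $ j)) \<in> H) \<and>
     compact H \<and> connected H"

definition torus_action :: "'a topology \<Rightarrow> (complex ^ 'm \<Rightarrow> 'a \<Rightarrow> 'a) \<Rightarrow> bool" where
  "torus_action X act \<longleftrightarrow>
     (\<forall>t\<in>torus. \<forall>x\<in>topspace X. act t x \<in> topspace X) \<and>
     (\<forall>x\<in>topspace X. act 1 x = x) \<and>
     (\<forall>s\<in>torus. \<forall>t\<in>torus. \<forall>x\<in>topspace X. act (s * t) x = act s (act t x)) \<and>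
     continuous_map (prod_topology (top_of_set torus) X) X (\<lambda>(t, x). act t x)"

definition effective_action :: "'a topology \<Rightarrow> (complex ^ 'm \<Rightarrow> 'a \<Rightarrow> 'a) \<Rightarrow> bool" where
  "effective_action X act \<longleftrightarrow>
     (\<forall>t\<in>torus. (\<forall>x\<in>topspace X. act t x = x) \<longrightarrow> t = 1)"

definition stabilizer :: "'a topology \<Rightarrow> (complex ^ 'm \<Rightarrow> 'a \<Rightarrow> 'a) \<Rightarrow> 'a \<Rightarrow> (complex ^ 'm) set" where
  "stabilizer X act x = {t \<in> torus. act t x = x}"

definition orbit :: "(complex ^ 'm \<Rightarrow> 'a \<Rightarrow> 'a) \<Rightarrow> 'a \<Rightarrow> 'a set" where
  "orbit act x = (\<lambda>t. act t x) ` torus"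

definition invariant_set :: "(complex ^ 'm \<Rightarrow> 'a \<Rightarrow> 'a) \<Rightarrow> 'a set \<Rightarrow> bool" where
  "invariant_set act U \<longleftrightarrow> (\<forall>t\<in>torus. \<forall>y\<in>U. act t y \<in> U)"

definition free_part :: "'a topology \<Rightarrow> (complex ^ 'm \<Rightarrow> 'a \<Rightarrow> 'a) \<Rightarrow> 'a set" where
  "free_part X act = {x \<in> topspace X. stabilizer X act x = {1}}"

definition sing_part :: "'a topology \<Rightarrow> (complex ^ 'm \<Rightarrow> 'a \<Rightarrow> 'a) \<Rightarrow> 'a set" where
  "sing_part X act = {x \<in> topspace X. stabilizer X act x \<noteq> {1}}"

definition quotient_topology :: "'a topology \<Rightarrow> ('a \<Rightarrow> 'b) \<Rightarrow> 'b topology" where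
  "quotient_topology P q =
     topology (\<lambda>V. V \<subseteq> q ` topspace P \<and> openin P {p \<in> topspace P. q p \<in> V})"

text \<open>Open cone c(L) = L x [0,1) / (L x {0}); points are equivalence classes.
For L empty it is a single point.\<close>
definition cone_class :: "'a topology \<Rightarrow> 'a \<times> real \<Rightarrow> ('a \<times> real) set" where
  "cone_class L p = (if snd p = 0 then topspace L \<times> {0} else {p})"

definition open_cone :: "'a topology \<Rightarrow> ('a \<times> real) set topology" where
  "open_cone L =
     topology (\<lambda>V. V \<subseteq> insert (topspace L \<times> {0}) (cone_class L ` (topspace L \<times> {0..<1})) \<and>
       openin (prod_topology L (top_of_set {0..<1}))
         {p \<in> topspace L \<times> {0..<1}. cone_class L p \<in> V})"

text \<open>Free model Omega x U(1)^(m-1) (coordinate i0 is the Omega-coordinate), with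
T^m = U(1) x U(1)^(m-1) acting by componentwise multiplication.\<close>
definition free_model :: "'m \<Rightarrow> complex set \<Rightarrow> (complex ^ 'm) set" where
  "free_model i0 \<Omega> = {v. v $ i0 \<in> \<Omega> \<and> (\<forall>j. j \<noteq> i0 \<longrightarrow> norm (v $ j) = 1)}"

text \<open>Singular model U(1)^(m-1) x c(L), where L = T_x x F is a finite disjoint union
of copies of the circle T_x = U(1) (coordinate i0), U(1)^(m-1) is realised as
the coordinates different from i0.\<close>
definition sub_torus_complement :: "'m \<Rightarrow> (complex ^ 'm) set" where
  "sub_torus_complement i0 = {u \<in> torus. u $ i0 = 1}"

definition sing_model :: "'m \<Rightarrow> nat set \<Rightarrow>
    ((complex ^ 'm) \<times> ((complex \<times> nat) \<times> real) set) topology" where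
  "sing_model i0 F =
     prod_topology (top_of_set (sub_torus_complement i0))
       (open_cone (prod_topology (top_of_set (sphere 0 1)) (discrete_topology F)))"

definition sing_act :: "'m \<Rightarrow> complex ^ 'm \<Rightarrow>
    (complex ^ 'm) \<times> ((complex \<times> nat) \<times> real) set \<Rightarrow>
    (complex ^ 'm) \<times> ((complex \<times> nat) \<times> real) set" where
  "sing_act i0 t p =
     ((\<chi> j. if j = i0 then 1 else t $ j) * fst p,
      (\<lambda>((c, f), r). ((t $ i0 * c, f), r)) ` snd p)"

definition locally_standard_over_graph ::
    "'a topology \<Rightarrow> (complex ^ 'm \<Rightarrow> 'a \<Rightarrow> 'a) \<Rightarrow> bool" where
  "locally_standard_over_graph X act \<longleftrightarrow>
     second_countable X \<and> compact_space X \<and> Hausdorff_space X \<and>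
     torus_action X act \<and> effective_action X act \<and>
     (\<forall>x\<in>topspace X. subtorus (stabilizer X act x)) \<and>
     X closure_of (free_part X act) = topspace X \<and>
     (\<forall>x\<in>free_part X act. \<exists>U i0 \<Omega> \<phi> h.
        openin X U \<and> x \<in> U \<and> invariant_set act U \<and>
        open \<Omega> \<and> 0 \<notin> \<Omega> \<and> (\<forall>z\<in>\<Omega>. \<forall>c. norm c = 1 \<longrightarrow> c * z \<in> \<Omega>) \<and>
        torus_aut \<phi> \<and>
        homeomorphic_map (subtopology X U) (top_of_set (free_model i0 \<Omega>)) h \<and>
        (\<forall>t\<in>torus. \<forall>y\<in>U. h (act t y) = \<phi> t * h y)) \<and>
     (\<forall>x\<in>sing_part X act. \<exists>U i0 F \<phi> h.
        openin X U \<and> x \<in> U \<and> invariant_set act U \<and> finite F \<and>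
        torus_aut \<phi> \<and>
        homeomorphic_map (subtopology X U) (sing_model i0 F) h \<and>
        (\<forall>t\<in>torus. \<forall>y\<in>U. h (act t y) = sing_act i0 (\<phi> t) (h y)))"

definition orbit_space :: "'a topology \<Rightarrow> (complex ^ 'm \<Rightarrow> 'a \<Rightarrow> 'a) \<Rightarrow> 'a set topology" where
  "orbit_space X act = quotient_topology X (orbit act)"

definition orbit_space_Q0 :: "'a topology \<Rightarrow> (complex ^ 'm \<Rightarrow> 'a \<Rightarrow> 'a) \<Rightarrow> 'a set set" where
  "orbit_space_Q0 X act = orbit act ` sing_part X act"

definition strata :: "'a topology \<Rightarrow> (complex ^ 'm \<Rightarrow> 'a \<Rightarrow> 'a) \<Rightarrow> 'a set set set" where
  "strata X act =
     connected_components_of (subtopology (orbit_space X act) (orbit_space_Q0 X act)) \<union>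
     connected_components_of (subtopology (orbit_space X act)
        (topspace (orbit_space X act) - orbit_space_Q0 X act))"

definition char_fun :: "'a topology \<Rightarrow> (complex ^ 'm \<Rightarrow> 'a \<Rightarrow> 'a) \<Rightarrow> 'a set set \<Rightarrow> (complex ^ 'm) set" where
  "char_fun X act S =
     (THE H. \<forall>x\<in>topspace X. orbit act x \<in> S \<longrightarrow> stabilizer X act x = H)"

definition stratified_homeo ::
    "'a topology \<Rightarrow> (complex ^ 'm \<Rightarrow> 'a \<Rightarrow> 'a) \<Rightarrow> 'b topology \<Rightarrow> (complex ^ 'm \<Rightarrow> 'b \<Rightarrow> 'b)
      \<Rightarrow> ('a set \<Rightarrow> 'b set) \<Rightarrow> bool" where
  "stratified_homeo X act X' act' f \<longleftrightarrow>
     homeomorphic_map (orbit_space X act) (orbit_space X' act') f \<and>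
     f ` orbit_space_Q0 X act \<subseteq> orbit_space_Q0 X' act' \<and>
     (\<forall>S\<in>strata X act. f ` S \<in> strata X' act')"

text \<open>Isomorphism / weak isomorphism of characteristic data (Q, lambda, 0);
the condition on c^free is vacuous since c^free = 0 for X over a graph.\<close>
definition char_data_iso ::
    "'a topology \<Rightarrow> (complex ^ 'm \<Rightarrow> 'a \<Rightarrow> 'a) \<Rightarrow> 'b topology \<Rightarrow> (complex ^ 'm \<Rightarrow> 'b \<Rightarrow> 'b) \<Rightarrow> bool" where
  "char_data_iso X act X' act' \<longleftrightarrow>
     (\<exists>f. stratified_homeo X act X' act' f \<and>
        (\<forall>S\<in>strata X act. char_fun X act S = char_fun X' act' (f ` S)))"

definition char_data_weak_iso ::
    "'a topology \<Rightarrow> (complex ^ 'm \<Rightarrow> 'a \<Rightarrow> 'a) \<Rightarrow> 'b topology \<Rightarrow> (complex ^ 'm \<Rightarrow> 'b \<Rightarrow> 'b) \<Rightarrow> bool" where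
  "char_data_weak_iso X act X' act' \<longleftrightarrow>
     (\<exists>f \<psi>. stratified_homeo X act X' act' f \<and> torus_aut \<psi> \<and>
        (\<forall>S\<in>strata X act. \<psi> ` char_fun X act S = char_fun X' act' (f ` S)))"

definition equivariant_homeomorphic ::
    "'a topology \<Rightarrow> (complex ^ 'm \<Rightarrow> 'a \<Rightarrow> 'a) \<Rightarrow> 'b topology \<Rightarrow> (complex ^ 'm \<Rightarrow> 'b \<Rightarrow> 'b) \<Rightarrow> bool" where
  "equivariant_homeomorphic X act X' act' \<longleftrightarrow>
     (\<exists>F. homeomorphic_map X X' F \<and>
        (\<forall>t\<in>torus. \<forall>x\<in>topspace X. F (act t x) = act' t (F x)))"

definition weakly_equivariant_homeomorphic ::
    "'a topology \<Rightarrow> (complex ^ 'm \<Rightarrow> 'a \<Rightarrow> 'a) \<Rightarrow> 'b topology \<Rightarrow> (complex ^ 'm \<Rightarrow> 'b \<Rightarrow> 'b) \<Rightarrow> bool" where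
  "weakly_equivariant_homeomorphic X act X' act' \<longleftrightarrow>
     (\<exists>F \<psi>. homeomorphic_map X X' F \<and> torus_aut \<psi> \<and>
        (\<forall>t\<in>torus. \<forall>x\<in>topspace X. F (act t x) = act' (\<psi> t) (F x)))"

end

theory Submission
  imports Defs
begin

text \<open>
  The orbit map of such an X has a global continuous section: near a singular orbit the cone
  structure provides one, and on the remaining compact part of the free orbits, which is covered by
  finitely many charts with orbit space in the real line, a section over a closed set is extended
  chart by chart, because a circle-valued map on a compact subset of the line extends to the line.
  Given sections s and s', a stratified homeomorphism f of the orbit spaces is covered by
  t s(q) \<mapsto> \<psi>(t) s'(f(q)), which is well defined and injective since \<psi> matches the stabilizers. It is
  continuous as T \<times> Q \<rightarrow> X is a quotient map, hence a homeomorphism by compactness.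
\<close>

section \<open>Circle-valued maps, tori, quotients and cones\<close>

text \<open>Extending a section over a free chart is a lifting problem for torus-valued maps, posed
  on the overlap as seen in the orbit space. That overlap is merely some compact set of reals,
  possibly with infinitely many components, so filling gaps interval by interval is no option. The
  obstruction is its first Cech cohomology with integral coefficients, which vanishes for every
  compact subset of the line.

  At a singular orbit the phase in the direction of the stabilizer is undefined, so two sections
  cannot be matched there by extending phases. Singular orbits are therefore treated before the free
  charts, on disjoint closed neighbourhoods, where nothing has to match. All pieces are closed and
  invariant: closedness lets continuous maps be pasted, and invariance lets the pasted map stay
  constant on orbits.\<close>

lemma compact_real_Borsukian:
  fixes K :: "real set"
  assumes "compact K"
  shows "Borsukian K"
proof -
  have "homotopic_with_canon (\<lambda>h. True) C (- {0::complex}) f g"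
    if "C \<in> components K" "continuous_on C f" "f \<in> C \<rightarrow> - {0}" "continuous_on C g" "g \<in> C \<rightarrow> - {0}"
    for C f g
  proof -
    have "Borsukian C"
      using that(1) in_components_connected convex_imp_Borsukian is_interval_convex_1 is_interval_connected_1
      by metis
    then show ?thesis
      using that unfolding Borsukian_alt by blast
  qed
  \<comment> \<open>Triviality on each component, an interval, does not pass formally to
    \<open>K\<close>, whose components may accumulate. It passes because \<open>K\<close> is compact
    and the target is an ANR.\<close>
  moreover have "ANR (- {0::complex})"
    by (intro open_imp_ANR) (simp add: open_Compl)
  ultimately show ?thesis
    unfolding Borsukian_alt
    using iffD2[OF cohomotopically_trivial_on_components[of K "- {0::complex}"]] assms
    by simp
qed

text \<open>Extending \<open>u\<close> directly as a complex function could produce zeros. Instead a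
  real angle, available because \<open>K\<close> is Borsukian, is extended by Tietze and
  exponentiated, which keeps modulus one.\<close>

lemma circle_map_extension:
  fixes K :: "real set" and u :: "real \<Rightarrow> complex"
  assumes K: "compact K" and cont: "continuous_on K u" and u: "\<And>x. x \<in> K \<Longrightarrow> norm (u x) = 1"
  shows "\<exists>w. continuous_on UNIV w \<and> (\<forall>x. norm (w x) = 1) \<and> (\<forall>x\<in>K. w x = u x)"
proof -
  have "\<exists>g. continuous_on K (complex_of_real \<circ> g) \<and> (\<forall>x\<in>K. u x = exp (\<i> * of_real (g x)))"
    by (rule compact_real_Borsukian[OF K, unfolded Borsukian_continuous_logarithm_circle_real, rule_format])
       (simp add: cont u Pi_iff)
  then obtain g where g: "continuous_on K (complex_of_real \<circ> g)"
      "\<And>x. x \<in> K \<Longrightarrow> u x = exp (\<i> * of_real (g x))" by blast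
  have "continuous_on K (\<lambda>x. Re ((complex_of_real \<circ> g) x))"
    using g(1) by (rule continuous_on_Re)
  then have "continuous_on K g" by simp
  then obtain G where G: "continuous_on UNIV G" "\<And>x. x \<in> K \<Longrightarrow> G x = g x"
    by (rule Tietze_unbounded[of K g UNIV]) (simp_all add: compact_imp_closed[OF K] flip: closed_closedin)
  have "continuous_on UNIV (\<lambda>x. exp (\<i> * of_real (G x)))"
    by (intro continuous_intros G)
  then show ?thesis
    using G g by (intro exI[of _ "\<lambda>x. exp (\<i> * of_real (G x))"]) simp
qed

section \<open>The torus as a compact group, and its automorphisms\<close>

lemma torus_one: "1 \<in> torus"
  by (simp add: torus_def)

lemma torus_mult: "s \<in> torus \<Longrightarrow> t \<in> torus \<Longrightarrow> s * t \<in> torus"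
  by (simp add: torus_def norm_mult)

lemma torus_inverse:
  assumes "t \<in> torus"
  obtains s where "s \<in> torus" "s * t = 1"
proof
  show "(\<chi> j. inverse (t $ j)) \<in> torus"
    using assms by (simp add: torus_def norm_inverse)
  have "t $ j \<noteq> 0" for j
    using assms unfolding torus_def by (metis (mono_tags) mem_Collect_eq norm_zero zero_neq_one)
  then show "(\<chi> j. inverse (t $ j)) * t = 1"
    by (simp add: vec_eq_iff)
qed

lemma compact_torus: "compact (torus :: (complex ^ 'm) set)"
proof -
  have "closed (torus :: (complex ^ 'm) set)"
    unfolding torus_def by (intro closed_Collect_all closed_Collect_eq continuous_intros)
  moreover have "norm t \<le> (\<Sum>i\<in>(UNIV::'m set). 1)" if "t \<in> torus" for t :: "complex ^ 'm"
    using that L2_set_le_sum[of UNIV "\<lambda>i. norm (t $ i)"]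
    by (simp add: torus_def norm_vec_def)
  then have "bounded (torus :: (complex ^ 'm) set)"
    unfolding bounded_iff by blast
  ultimately show ?thesis
    by (simp add: compact_eq_bounded_closed)
qed

lemma torus_aut_image: "torus_aut \<phi> \<Longrightarrow> \<phi> ` torus = torus"
  unfolding torus_aut_def using homeomorphism_image1 by metis

lemma torus_aut_in: "torus_aut \<phi> \<Longrightarrow> t \<in> torus \<Longrightarrow> \<phi> t \<in> torus"
  using imageI[of t torus \<phi>] by (simp add: torus_aut_image)

lemma torus_aut_mult: "torus_aut \<phi> \<Longrightarrow> s \<in> torus \<Longrightarrow> t \<in> torus \<Longrightarrow> \<phi> (s * t) = \<phi> s * \<phi> t"
  unfolding torus_aut_def by simp

lemma torus_aut_inj: "torus_aut \<phi> \<Longrightarrow> inj_on \<phi> torus"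
  unfolding torus_aut_def using homeomorphism_apply1 inj_on_inverseI by metis

lemma torus_aut_continuous: "torus_aut \<phi> \<Longrightarrow> continuous_on torus \<phi>"
  unfolding torus_aut_def using homeomorphism_cont1 by metis

lemma torus_aut_one:
  assumes "torus_aut \<phi>" shows "\<phi> 1 = 1"
proof -
  obtain s where "s \<in> torus" "s * \<phi> 1 = 1"
    using torus_inverse torus_aut_in[OF assms torus_one] by blast
  moreover have "s * (\<phi> 1 * \<phi> 1) = s * \<phi> 1"
    using torus_aut_mult[OF assms torus_one torus_one] by simp
  ultimately show ?thesis
    by (simp flip: mult.assoc)
qed

lemma torus_aut_eq_one:
  "torus_aut \<phi> \<Longrightarrow> t \<in> torus \<Longrightarrow> \<phi> t = 1 \<Longrightarrow> t = 1"
  by (rule inj_onD[OF torus_aut_inj[of \<phi>]]) (simp_all add: torus_aut_one torus_one)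

lemma torus_aut_surj:
  assumes "torus_aut \<phi>" "s \<in> torus"
  obtains t where "t \<in> torus" "\<phi> t = s"
  by (metis assms image_iff torus_aut_image)

lemma torus_aut_id: "torus_aut (\<lambda>t. t)"
  unfolding torus_aut_def homeomorphism_def by (intro conjI exI[of _ "\<lambda>t. t"]) simp_all

section \<open>Coinduced topologies: quotients and open cones\<close>

text \<open>The carrier \<open>C\<close> is a parameter so that open cones are covered too: there
  the apex is inserted into the carrier, and for an empty link it is not a value of
  \<open>cone_class\<close>.\<close>

lemma istopology_coinduced:
  "istopology (\<lambda>V. V \<subseteq> C \<and> openin P {p \<in> topspace P. q p \<in> V})"
  unfolding istopology_def
proof (intro conjI allI impI)
  fix S T
  assume "S \<subseteq> C \<and> openin P {p \<in> topspace P. q p \<in> S}" "T \<subseteq> C \<and> openin P {p \<in> topspace P. q p \<in> T}"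
  then have *: "S \<inter> T \<subseteq> C" "openin P ({p \<in> topspace P. q p \<in> S} \<inter> {p \<in> topspace P. q p \<in> T})"
    by blast+
  moreover have "{p \<in> topspace P. q p \<in> S} \<inter> {p \<in> topspace P. q p \<in> T} = {p \<in> topspace P. q p \<in> S \<inter> T}"
    by blast
  ultimately show "S \<inter> T \<subseteq> C" "openin P {p \<in> topspace P. q p \<in> S \<inter> T}" by simp_all
next
  fix \<K> assume *: "\<forall>K\<in>\<K>. K \<subseteq> C \<and> openin P {p \<in> topspace P. q p \<in> K}"
  then show "\<Union>\<K> \<subseteq> C" by blast
  have "openin P (\<Union>K\<in>\<K>. {p \<in> topspace P. q p \<in> K})"
    using * by blast
  moreover have "(\<Union>K\<in>\<K>. {p \<in> topspace P. q p \<in> K}) = {p \<in> topspace P. q p \<in> \<Union>\<K>}" by blast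
  ultimately show "openin P {p \<in> topspace P. q p \<in> \<Union>\<K>}" by simp
qed

lemma openin_quotient_topology:
  "openin (quotient_topology P q) V \<longleftrightarrow> V \<subseteq> q ` topspace P \<and> openin P {p \<in> topspace P. q p \<in> V}"
  unfolding quotient_topology_def by (subst topology_inverse'[OF istopology_coinduced]) simp

lemma topspace_quotient_topology: "topspace (quotient_topology P q) = q ` topspace P"
proof
  show "topspace (quotient_topology P q) \<subseteq> q ` topspace P"
    using openin_topspace[of "quotient_topology P q"] unfolding openin_quotient_topology by (rule conjunct1)
  have "{p \<in> topspace P. q p \<in> q ` topspace P} = topspace P"
    by blast
  then have "openin (quotient_topology P q) (q ` topspace P)"
    by (simp add: openin_quotient_topology)
  then show "q ` topspace P \<subseteq> topspace (quotient_topology P q)"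
    by (rule openin_subset)
qed

lemma quotient_map_quotient_topology: "quotient_map P (quotient_topology P q) q"
  unfolding quotient_map_def by (simp add: openin_quotient_topology topspace_quotient_topology)

lemma openin_open_cone:
  "openin (open_cone L) V \<longleftrightarrow>
     V \<subseteq> insert (topspace L \<times> {0}) (cone_class L ` (topspace L \<times> {0..<1})) \<and>
     openin (prod_topology L (top_of_set {0..<1})) {p \<in> topspace L \<times> {0..<1}. cone_class L p \<in> V}"
proof -
  have "topspace L \<times> {0..<1} = topspace (prod_topology L (top_of_set {0..<1::real}))"
    by simp
  then show ?thesis
    unfolding open_cone_def by (simp only: topology_inverse'[OF istopology_coinduced])
qed

lemma topspace_open_cone:
  "topspace (open_cone L) = insert (topspace L \<times> {0}) (cone_class L ` (topspace L \<times> {0..<1}))"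
    (is "_ = ?C")
proof
  show "topspace (open_cone L) \<subseteq> ?C"
    using openin_topspace[of "open_cone L"] unfolding openin_open_cone by (rule conjunct1)
  have "{p \<in> topspace L \<times> {0..<1}. cone_class L p \<in> ?C} = topspace L \<times> {0..<1}"
    by blast
  then have "openin (open_cone L) ?C"
    by (simp add: openin_open_cone openin_prod_Times_iff)
  then show "?C \<subseteq> topspace (open_cone L)"
    by (rule openin_subset)
qed

lemma continuous_map_cone_class:
  "continuous_map (prod_topology L (top_of_set {0..<1})) (open_cone L) (cone_class L)"
  unfolding continuous_map_def openin_open_cone topspace_open_cone Pi_iff by simp

text \<open>The cone topology is coinduced, so preimages are tested on representatives. The first
  assumption takes care of the empty link, whose apex has no representative for the composite to
  see.\<close>

lemma continuous_map_from_open_cone: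
  assumes "g (topspace L \<times> {0}) \<in> topspace Y"
    and "continuous_map (prod_topology L (top_of_set {0..<1})) Y (g \<circ> cone_class L)"
  shows "continuous_map (open_cone L) Y g"
  unfolding continuous_map_def
proof (intro conjI allI impI)
  show "g \<in> topspace (open_cone L) \<rightarrow> topspace Y"
    using assms unfolding topspace_open_cone continuous_map_def Pi_iff by simp
  fix V assume "openin Y V"
  with assms(2) have "openin (prod_topology L (top_of_set {0..<1}))
      {p \<in> topspace L \<times> {0..<1}. g (cone_class L p) \<in> V}"
    by (simp add: continuous_map_def)
  moreover have "{p \<in> topspace L \<times> {0..<1}. g (cone_class L p) \<in> V} =
     {p \<in> topspace L \<times> {0..<1}. cone_class L p \<in> {x \<in> topspace (open_cone L). g x \<in> V}}"
    by (auto simp: topspace_open_cone)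
  ultimately show "openin (open_cone L) {x \<in> topspace (open_cone L). g x \<in> V}"
    unfolding openin_open_cone using topspace_open_cone[of L] by (simp add: subset_eq)
qed

section \<open>Sections over invariant sets and free charts\<close>

text \<open>A section over A/T is encoded by its composite with the orbit map, so that no quotient
  topology enters the construction.\<close>

definition section_on ::
    "'a topology \<Rightarrow> (complex ^ 'm \<Rightarrow> 'a \<Rightarrow> 'a) \<Rightarrow> 'a set \<Rightarrow> ('a \<Rightarrow> 'a) \<Rightarrow> bool" where
  "section_on X act A r \<longleftrightarrow>
     continuous_map (subtopology X A) X r \<and>
     (\<forall>x\<in>A. r x \<in> orbit act x \<and> (\<forall>t\<in>torus. r (act t x) = r x))"

locale compact_torus_space =
  fixes X :: "'a topology" and act :: "complex ^ 'm \<Rightarrow> 'a \<Rightarrow> 'a"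
  assumes compact: "compact_space X" and Hausdorff: "Hausdorff_space X"
    and action: "torus_action X act"
begin

lemma act_in: "t \<in> torus \<Longrightarrow> x \<in> topspace X \<Longrightarrow> act t x \<in> topspace X"
  using action by (simp add: torus_action_def)

lemma act_one: "x \<in> topspace X \<Longrightarrow> act 1 x = x"
  using action by (simp add: torus_action_def)

lemma act_mult:
  "s \<in> torus \<Longrightarrow> t \<in> torus \<Longrightarrow> x \<in> topspace X \<Longrightarrow> act (s * t) x = act s (act t x)"
  using action by (simp add: torus_action_def)

lemma continuous_act: "continuous_map (prod_topology (top_of_set torus) X) X (\<lambda>(t, x). act t x)"
  using action by (simp add: torus_action_def)

lemma continuous_act_fixed:
  assumes "t \<in> torus" shows "continuous_map X X (act t)"
proof -
  have "continuous_map X (prod_topology (top_of_set torus) X) (\<lambda>x. (t, x))"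
    using assms by (simp add: continuous_map_pairedI)
  from continuous_map_compose[OF this continuous_act] show ?thesis
    by (simp add: o_def)
qed

lemma act_inverse:
  assumes "t \<in> torus"
  obtains s where "s \<in> torus" "\<And>x. x \<in> topspace X \<Longrightarrow> act s (act t x) = x"
    "\<And>x. x \<in> topspace X \<Longrightarrow> act t (act s x) = x"
proof -
  obtain s where s: "s \<in> torus" "s * t = 1"
    using torus_inverse assms by blast
  moreover have "t * s = 1"
    using s(2) by (simp add: mult.commute)
  ultimately show ?thesis
    using that[of s] assms act_one by (metis act_mult)
qed

lemma orbit_self: "x \<in> topspace X \<Longrightarrow> x \<in> orbit act x"
  unfolding orbit_def using torus_one by (metis act_one image_eqI)

lemma orbit_subset: "x \<in> topspace X \<Longrightarrow> orbit act x \<subseteq> topspace X"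
  unfolding orbit_def using act_in by blast

lemma orbitE:
  assumes "y \<in> orbit act x" obtains t where "t \<in> torus" "y = act t x"
  using assms unfolding orbit_def by blast

lemma act_in_orbit: "t \<in> torus \<Longrightarrow> act t x \<in> orbit act x"
  unfolding orbit_def by blast

lemma orbit_act:
  assumes "t \<in> torus" "x \<in> topspace X" shows "orbit act (act t x) = orbit act x"
proof -
  have sub: "orbit act (act t x) \<subseteq> orbit act x" if "t \<in> torus" "x \<in> topspace X" for t x
  proof
    fix y assume "y \<in> orbit act (act t x)"
    then obtain s where "s \<in> torus" "y = act s (act t x)" by (rule orbitE)
    then show "y \<in> orbit act x"
      using that act_in_orbit[OF torus_mult, of s t x] act_mult[of s t x] by simp
  qed
  obtain s where s: "s \<in> torus" "act s (act t x) = x"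
    using act_inverse assms by metis
  show ?thesis
    using sub[OF assms] sub[OF s(1), of "act t x"] s(2) act_in[OF assms] by simp
qed

lemma orbit_eq: "x \<in> topspace X \<Longrightarrow> y \<in> orbit act x \<Longrightarrow> orbit act y = orbit act x"
  using orbit_act by (metis orbitE)

lemma act_translate_iff:
  assumes "s \<in> torus" "d \<in> torus" "x \<in> topspace X"
  shows "act (s * d) x = act s x \<longleftrightarrow> act d x = x"
  using assms act_inverse[OF assms(1)] act_in by (metis act_mult)

text \<open>Stabilizers along an orbit are conjugate, hence equal in an abelian group.\<close>

lemma stabilizer_act:
  assumes "t \<in> torus" "x \<in> topspace X"
  shows "stabilizer X act (act t x) = stabilizer X act x"
proof -
  have "act d (act t x) = act t x \<longleftrightarrow> act d x = x" if "d \<in> torus" for d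
    using act_translate_iff[OF assms(1) that assms(2)] act_mult[OF that assms] by (simp add: mult.commute)
  then show ?thesis
    unfolding stabilizer_def by blast
qed

lemma stabilizer_orbit:
  "x \<in> topspace X \<Longrightarrow> y \<in> orbit act x \<Longrightarrow> stabilizer X act y = stabilizer X act x"
  using stabilizer_act by (metis orbitE)

lemma invariant_orbit_subset: "invariant_set act U \<Longrightarrow> x \<in> U \<Longrightarrow> orbit act x \<subseteq> U"
  unfolding invariant_set_def orbit_def by blast

text \<open>Regularity gives an open \<open>V\<close> inside a closed \<open>D\<close> inside
  \<open>U\<close>, and both are saturated by the torus. The translates of \<open>V\<close> have an
  open union, while the saturation of \<open>D\<close> is the image of a compact set and so closed
  in a Hausdorff space; invariance of \<open>U\<close> keeps it inside \<open>U\<close>.\<close>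

lemma invariant_closed_neighbourhood:
  assumes "openin X U" "invariant_set act U" "x \<in> U"
  obtains W C where "openin X W" "invariant_set act W" "closedin X C" "invariant_set act C"
    "x \<in> W" "W \<subseteq> C" "C \<subseteq> U"
proof -
  have "neighbourhood_base_of (closedin X) X"
    using compact_Hausdorff_imp_regular_space[OF compact Hausdorff] by (simp add: neighbourhood_base_of_closedin)
  then obtain V D where VD: "openin X V" "closedin X D" "x \<in> V" "V \<subseteq> D" "D \<subseteq> U"
    unfolding neighbourhood_base_of using assms by metis
  define C where "C = (\<lambda>(t, x). act t x) ` (torus \<times> D)"
  define W where "W = (\<Union>t\<in>torus. act t ` V)"
  have Vtop: "V \<subseteq> topspace X" and Dtop: "D \<subseteq> topspace X"
    using VD openin_subset closedin_subset by blast+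
  show thesis
  proof
    have "openin X (act t ` V)" if t: "t \<in> torus" for t
    proof -
      obtain s where s: "s \<in> torus" "\<And>x. x \<in> topspace X \<Longrightarrow> act s (act t x) = x"
        "\<And>x. x \<in> topspace X \<Longrightarrow> act t (act s x) = x"
        using act_inverse t by blast
      have "act t ` V = {y \<in> topspace X. act s y \<in> V}"
      proof
        show "act t ` V \<subseteq> {y \<in> topspace X. act s y \<in> V}"
          using Vtop s act_in[OF t] by (auto simp: subset_iff)
        show "{y \<in> topspace X. act s y \<in> V} \<subseteq> act t ` V"
          using s(3) by (metis (mono_tags, lifting) image_eqI mem_Collect_eq subsetI)
      qed
      then show ?thesis
        using openin_continuous_map_preimage[OF continuous_act_fixed[OF s(1)] VD(1)] by simp
    qed
    then show "openin X W"
      unfolding W_def by blast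
    show "invariant_set act W"
      unfolding invariant_set_def W_def
    proof (intro ballI)
      fix s :: "complex ^ 'm" and y assume s: "s \<in> torus" and "y \<in> (\<Union>t\<in>torus. act t ` V)"
      then obtain t v where "t \<in> torus" "v \<in> V" "y = act t v" by blast
      then have "act s y = act (s * t) v" "s * t \<in> torus"
        using act_mult s Vtop torus_mult by auto
      then show "act s y \<in> (\<Union>t\<in>torus. act t ` V)"
        using \<open>v \<in> V\<close> by blast
    qed
    have "compactin (prod_topology (top_of_set torus) X) (torus \<times> D)"
      by (simp add: compactin_Times compact_torus compactin_subtopology closedin_compact_space compact VD)
    then have "compactin X C"
      unfolding C_def using image_compactin continuous_act by blast
    then show "closedin X C"
      by (rule compactin_imp_closedin[OF Hausdorff])
    show "invariant_set act C"
      unfolding invariant_set_def C_def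
    proof (intro ballI)
      fix s :: "complex ^ 'm" and y assume s: "s \<in> torus" and "y \<in> (\<lambda>(t, x). act t x) ` (torus \<times> D)"
      then obtain t v where "t \<in> torus" "v \<in> D" "y = act t v" by auto
      then have "act s y = act (s * t) v" "s * t \<in> torus"
        using act_mult s Dtop torus_mult by auto
      then show "act s y \<in> (\<lambda>(t, x). act t x) ` (torus \<times> D)"
        using \<open>v \<in> D\<close> by (metis (no_types, lifting) SigmaI case_prod_conv image_eqI)
    qed
    have "act 1 x \<in> W"
      using VD(3) torus_one unfolding W_def by blast
    then show "x \<in> W"
      using act_one VD(3) Vtop by auto
    show "W \<subseteq> C"
      unfolding W_def C_def using VD(4) by force
    show "C \<subseteq> U"
      unfolding C_def using VD(5) assms(2) by (auto simp: invariant_set_def)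
  qed
qed

section \<open>Pasting sections and extending them over free charts\<close>

lemma section_on_subset:
  "section_on X act A r \<Longrightarrow> B \<subseteq> A \<Longrightarrow> section_on X act B r"
  unfolding section_on_def using continuous_map_from_subtopology_mono by blast

text \<open>Two closed pieces can be pasted continuously. Since \<open>A\<close> is invariant, a
  whole orbit falls into the same branch of the case distinction, so the result is again constant on
  orbits.\<close>

lemma section_on_Un:
  assumes A: "closedin X A" "invariant_set act A" and B: "closedin X B"
    and r: "section_on X act A r" and q: "section_on X act B q"
    and agree: "\<And>x. x \<in> A \<inter> B \<Longrightarrow> r x = q x"
    and B': "invariant_set act B"
  shows "section_on X act (A \<union> B) (\<lambda>x. if x \<in> A then r x else q x)"
  unfolding section_on_def
proof (intro conjI ballI)
  let ?T = "\<lambda>b. if b then A else B" and ?f = "\<lambda>b. if b then r else q"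
  have sub: "A \<subseteq> topspace X" "B \<subseteq> topspace X"
    using A B closedin_subset by blast+
  show "continuous_map (subtopology X (A \<union> B)) X (\<lambda>x. if x \<in> A then r x else q x)"
  proof (rule pasting_lemma_closed[where I = UNIV and T = ?T and f = ?f])
    show "closedin (subtopology X (A \<union> B)) (?T i)" for i
      using A B by (simp add: closedin_closed_subtopology closedin_Un)
    show "continuous_map (subtopology (subtopology X (A \<union> B)) (?T i)) X (?f i)" for i
      using r q by (cases i) (simp_all add: section_on_def subtopology_subtopology Int_absorb1)
  qed (use agree sub in \<open>auto split: if_splits\<close>)
  fix x and t :: "complex ^ 'm" assume x: "x \<in> A \<union> B"
  show "(if x \<in> A then r x else q x) \<in> orbit act x"
    using x r q by (auto simp: section_on_def)
  assume t: "t \<in> torus"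
  show "(if act t x \<in> A then r (act t x) else q (act t x)) = (if x \<in> A then r x else q x)"
  proof (cases "x \<in> A")
    case True
    then show ?thesis
      using r t A by (simp add: section_on_def invariant_set_def)
  next
    case False
    then have "x \<in> B" using x by blast
    have "act t x \<notin> A"
    proof
      assume "act t x \<in> A"
      obtain s where "s \<in> torus" "act s (act t x) = x"
        using act_inverse[OF t] \<open>x \<in> B\<close> sub(2) by (metis subsetD)
      then show False
        using \<open>act t x \<in> A\<close> A(2) False unfolding invariant_set_def by metis
    qed
    then show ?thesis
      using q t False \<open>x \<in> B\<close> by (simp add: section_on_def)
  qed
qed

text \<open>In the free model an orbit is a level set of the modulus of coordinate
  \<open>i0\<close>, the other moduli being one. A section over the chart thus amounts to one phase
  per coordinate as a function of that modulus. The phases of \<open>r\<close> on the overlap are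
  extended to the whole line, so the new section agrees with \<open>r\<close> there and can be
  pasted to it.\<close>

lemma section_on_free_chart:
  assumes A: "closedin X A" "invariant_set act A" "section_on X act A r"
    and B: "closedin X B" "invariant_set act B" "B \<subseteq> U"
    and U: "openin X U" "invariant_set act U"
    and \<Omega>: "0 \<notin> \<Omega>" "\<forall>z\<in>\<Omega>. \<forall>c. norm c = 1 \<longrightarrow> c * z \<in> \<Omega>"
    and \<phi>: "torus_aut \<phi>"
    and h: "homeomorphic_map (subtopology X U) (top_of_set (free_model i0 \<Omega>)) h"
    and equiv: "\<forall>t\<in>torus. \<forall>y\<in>U. h (act t y) = \<phi> t * h y"
  obtains r' where "section_on X act (A \<union> B) r'"
proof -
  let ?M = "free_model i0 \<Omega>"
  have Utop: "U \<subseteq> topspace X"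
    using U openin_subset by blast
  then have [simp]: "topspace X \<inter> U = U" by auto
  obtain k where "homeomorphic_maps (subtopology X U) (top_of_set ?M) h k"
    using h homeomorphic_map_maps by blast
  then have hcont: "continuous_map (subtopology X U) (top_of_set ?M) h"
    and kcont: "continuous_map (top_of_set ?M) (subtopology X U) k"
    and kh: "\<And>y. y \<in> U \<Longrightarrow> k (h y) = y" and hk: "\<And>v. v \<in> ?M \<Longrightarrow> h (k v) = v"
    unfolding homeomorphic_maps_def by auto
  have hM: "h y \<in> ?M" if "y \<in> U" for y
    using continuous_map_funspace[OF hcont] that by auto
  have kU: "k v \<in> U" if "v \<in> ?M" for v
    using continuous_map_funspace[OF kcont] that by auto
  have Mnz: "v $ j \<noteq> 0" if "v \<in> ?M" for v j
    using that \<Omega>(1) unfolding free_model_def by (cases "j = i0") auto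
  have hnorm: "norm (h y $ j) = 1" if "y \<in> U" "j \<noteq> i0" for y j
    using hM[OF that(1)] that(2) by (simp add: free_model_def)
  \<comment> \<open>\<rho> embeds the orbit space of U into the reals; over the compact set \<rho> (A \<inter> B) the coordinate
    phases of r become circle-valued functions, which extend.\<close>
  define \<rho> where "\<rho> y = norm (h y $ i0)" for y
  have \<rho>_act: "\<rho> (act t y) = \<rho> y" if "t \<in> torus" "y \<in> U" for t y
    using equiv that torus_aut_in[OF \<phi> that(1)] by (simp add: \<rho>_def torus_def norm_mult)
  have same_orbit: "z \<in> orbit act y" if "y \<in> U" "z \<in> U" "\<rho> y = \<rho> z" for y z
  proof -
    \<comment> \<open>The coordinatewise quotient carries \<open>h y\<close> to \<open>h z\<close>.
      It lies in the torus because the moduli agree: at \<open>i0\<close> by the assumption on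
      \<open>\<rho>\<close>, elsewhere because they are one.\<close>
    define s where "s = (\<chi> j. h z $ j / h y $ j)"
    have "norm (s $ j) = 1" for j
      using that hnorm[of y j] hnorm[of z j] Mnz[OF hM[OF that(1)], of j] Mnz[OF hM[OF that(2)], of j]
      unfolding s_def \<rho>_def
      by (cases "j = i0") (simp_all add: norm_divide)
    then have "s \<in> torus" by (simp add: torus_def)
    then obtain t where t: "t \<in> torus" "\<phi> t = s"
      using torus_aut_surj[OF \<phi>] by blast
    have "h (act t y) = h z"
      using equiv t that(1) Mnz[OF hM[OF that(1)]] by (simp add: s_def vec_eq_iff)
    then have "act t y = z"
      using kh that t U(2) unfolding invariant_set_def by metis
    then show ?thesis
      using act_in_orbit[OF t(1)] by blast
  qed
  define C where "C = A \<inter> B"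
  have C: "closedin X C" "C \<subseteq> U" "C \<subseteq> A" "C \<subseteq> topspace X"
    using A B Utop unfolding C_def by auto
  then have [simp]: "topspace X \<inter> C = C" by auto
  have rC: "r x \<in> U" "\<rho> (r x) = \<rho> x" "r x \<in> orbit act x" if "x \<in> C" for x
  proof -
    show "r x \<in> orbit act x"
      using A(3) that C by (auto simp: section_on_def)
    then obtain t where "t \<in> torus" "r x = act t x" by (rule orbitE)
    then show "r x \<in> U" "\<rho> (r x) = \<rho> x"
      using \<rho>_act that C(2) U(2) by (auto simp: invariant_set_def)
  qed
  have r_eq: "r x = r y" if "x \<in> C" "y \<in> C" "\<rho> x = \<rho> y" for x y
  proof -
    have "y \<in> orbit act x"
      using same_orbit that C(2) by blast
    then show ?thesis
      using A(3) that C(3) unfolding section_on_def by (metis orbitE subsetD)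
  qed
  have "continuous_map (subtopology X C) X r"
    using section_on_subset[OF A(3) C(3)] by (simp add: section_on_def)
  then have rcont: "continuous_map (subtopology X C) (subtopology X U) r"
    by (rule continuous_map_into_subtopology) (use rC in auto)
  have "continuous_map (subtopology X U) euclidean h"
    using hcont by (simp add: continuous_map_in_subtopology)
  moreover have "continuous_map euclidean euclidean (\<lambda>v::complex^'m. norm (v $ i0))"
    by (simp add: continuous_intros)
  ultimately have "continuous_map (subtopology X U) euclidean ((\<lambda>v. norm (v $ i0)) \<circ> h)"
    by (rule continuous_map_compose)
  then have \<rho>cont: "continuous_map (subtopology X U) euclidean \<rho>"
    by (simp add: o_def \<rho>_def[abs_def])
  have \<rho>C: "continuous_map (subtopology X C) (top_of_set (\<rho> ` C)) \<rho>"
    using continuous_map_from_subtopology_mono[OF \<rho>cont C(2)] by (simp add: continuous_map_into_subtopology)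
  have compC: "compact_space (subtopology X C)"
    using closedin_compact_space[OF compact C(1)] by (simp add: compact_space_subtopology)
  \<comment> \<open>A continuous surjection from a compact space onto a Hausdorff one is a quotient
    map, so continuity of the phases of \<open>r\<close> descends from \<open>C\<close> to its image
    in the reals.\<close>
  have quot: "quotient_map (subtopology X C) (top_of_set (\<rho> ` C)) \<rho>"
    by (rule continuous_imp_quotient_map[OF \<rho>C compC]) (auto simp: Hausdorff_space_subtopology)
  have "compactin (top_of_set (\<rho> ` C)) (\<rho> ` C)"
    using image_compactin[OF _ \<rho>C, of C] compC by (simp add: compact_space_def)
  then have compK: "compact (\<rho> ` C)"
    by (simp add: compactin_subtopology)
  have "\<exists>w. continuous_on UNIV w \<and> (\<forall>x. norm (w x) = 1) \<and> (\<forall>x\<in>C. w (\<rho> x) = sgn (h (r x) $ j))" for j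
  proof -
    have "continuous_on ?M (\<lambda>v. sgn (v $ j))"
      by (intro continuous_intros) (use Mnz in auto)
    then have "continuous_map (top_of_set ?M) euclidean (\<lambda>v. sgn (v $ j))"
      by simp
    from continuous_map_compose[OF continuous_map_compose[OF rcont hcont] this]
    have cont: "continuous_map (subtopology X C) euclidean (\<lambda>x. sgn (h (r x) $ j))"
      by (simp add: o_def)
    have eq: "sgn (h (r x) $ j) = sgn (h (r y) $ j)"
      if "x \<in> topspace (subtopology X C)" "y \<in> topspace (subtopology X C)" "\<rho> x = \<rho> y" for x y
      using r_eq[of x y] that by simp
    obtain u where u: "continuous_map (top_of_set (\<rho> ` C)) euclidean u"
        "\<And>x. x \<in> C \<Longrightarrow> u (\<rho> x) = sgn (h (r x) $ j)"
      by (rule quotient_map_lift_exists[OF quot cont eq]) simp_all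
    have unorm: "norm (u y) = 1" if "y \<in> \<rho> ` C" for y
    proof -
      obtain x where "x \<in> C" "y = \<rho> x" using \<open>y \<in> \<rho> ` C\<close> by (rule imageE)
      then show ?thesis
        using u(2) Mnz[OF hM[OF rC(1)]] by (simp add: norm_sgn)
    qed
    have "continuous_on (\<rho> ` C) u"
      using u(1) by simp
    from circle_map_extension[OF compK this unorm] show ?thesis
      using u(2) by simp
  qed
  then obtain w where w: "\<And>j. continuous_on UNIV (w j)" "\<And>j x. norm (w j x) = 1"
      "\<And>j x. x \<in> C \<Longrightarrow> w j (\<rho> x) = sgn (h (r x) $ j)"
    by metis
  \<comment> \<open>A normal form on the model: the modulus at \<open>i0\<close> is kept and every
    phase is replaced by the extended one. It depends only on that modulus, hence only on the
    orbit.\<close>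
  define \<mu> :: "complex^'m \<Rightarrow> complex^'m" where
    "\<mu> v = (\<chi> j. (if j = i0 then of_real (norm (v $ i0)) else 1) * w j (norm (v $ i0)))" for v
  have \<mu>M: "\<mu> v \<in> ?M" if "v \<in> ?M" for v
  proof -
    have vi: "v $ i0 \<in> \<Omega>" "v $ i0 \<noteq> 0"
      using that Mnz by (auto simp: free_model_def)
    \<comment> \<open>All that is known of \<open>\<Omega>\<close> here is rotation invariance and
      that it omits 0, so the new coordinate is exhibited as a unimodular multiple of the old
      one.\<close>
    let ?c = "of_real (norm (v $ i0)) * w i0 (norm (v $ i0)) / v $ i0"
    have "norm ?c = 1"
      using vi by (simp add: norm_divide norm_mult w)
    then have "?c * v $ i0 \<in> \<Omega>"
      using \<Omega>(2) vi(1) by blast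
    then show ?thesis
      using vi(2) by (simp add: free_model_def \<mu>_def w)
  qed
  have "continuous_on UNIV (\<lambda>v::complex^'m. w j (norm (v $ i0)))" for j
    by (rule continuous_on_compose2[OF w(1)]) (auto intro!: continuous_intros)
  moreover have "continuous_on UNIV (\<lambda>v::complex^'m. if j = i0 then complex_of_real (norm (v $ i0)) else 1)" for j
    by (cases "j = i0") (simp_all add: continuous_intros)
  ultimately have "continuous_on UNIV \<mu>"
    unfolding \<mu>_def[abs_def] by (intro continuous_on_vec_lambda continuous_on_mult)
  then have \<mu>cont: "continuous_map (top_of_set ?M) (top_of_set ?M) \<mu>"
    using \<mu>M continuous_on_subset[of UNIV \<mu> ?M] by (simp add: continuous_map_in_subtopology image_subset_iff)
  define q where "q = k \<circ> \<mu> \<circ> h"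
  have "continuous_map (subtopology X U) (subtopology X U) q"
    unfolding q_def by (intro continuous_map_compose[OF hcont] continuous_map_compose[OF \<mu>cont] kcont)
  then have "continuous_map (subtopology X U) X q"
    by (simp add: continuous_map_in_subtopology)
  then have qcont: "continuous_map (subtopology X B) X q"
    using B(3) by (rule continuous_map_from_subtopology_mono)
  have hq: "h (q y) = \<mu> (h y)" and qU: "q y \<in> U" if "y \<in> U" for y
    using hk kU \<mu>M hM that by (auto simp: q_def)
  have "q y \<in> orbit act y" if "y \<in> U" for y
  proof (rule same_orbit[OF that qU[OF that]])
    show "\<rho> y = \<rho> (q y)"
      unfolding \<rho>_def hq[OF that] by (simp add: \<mu>_def norm_mult w)
  qed
  moreover have "q (act t y) = q y" if "t \<in> torus" "y \<in> U" for t y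
    using \<rho>_act[OF that] unfolding q_def \<mu>_def \<rho>_def o_apply by (simp only:)
  ultimately have "section_on X act B q"
    unfolding section_on_def using qcont B(3) by blast
  moreover have "r x = q x" if "x \<in> A \<inter> B" for x
  proof -
    have x: "x \<in> C" "x \<in> U" using that C by (auto simp: C_def)
    have "h (r x) $ j = \<mu> (h x) $ j" for j
    proof -
      \<comment> \<open>Polar decomposition: on the overlap \<open>r x\<close> has the modulus of
        \<open>x\<close> at \<open>i0\<close>, and its phases are the values prescribed for
        \<open>w\<close>.\<close>
      have "h (r x) $ j = of_real (norm (h (r x) $ j)) * sgn (h (r x) $ j)"
        by (simp add: sgn_eq)
      also have "norm (h (r x) $ j) = (if j = i0 then \<rho> x else 1)"
        using rC[OF x(1)] hnorm by (auto simp: \<rho>_def)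
      finally show ?thesis
        using w(3)[OF x(1), of j] by (auto simp: \<mu>_def \<rho>_def)
    qed
    then have "h (r x) = h (q x)"
      using hq[OF x(2)] by (simp add: vec_eq_iff)
    then show ?thesis
      using kh rC(1)[OF x(1)] qU[OF x(2)] by metis
  qed
  ultimately show thesis
    using that section_on_Un[OF A(1,2) B(1) A(3) _ _ B(2)] by blast
qed

end

section \<open>Singular charts\<close>

lemma topspace_open_cone_cases:
  assumes "c \<in> topspace (open_cone L)"
  obtains "c = topspace L \<times> {0}"
  | p \<rho> where "c = {(p, \<rho>)}" "p \<in> topspace L" "0 < \<rho>" "\<rho> < 1"
proof -
  consider "c = topspace L \<times> {0}" | p \<rho> where "c = cone_class L (p, \<rho>)" "p \<in> topspace L" "0 \<le> \<rho>" "\<rho> < 1"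
    using assms unfolding topspace_open_cone by auto
  then show thesis
  proof cases
    case 2
    then show thesis
      using that by (cases "\<rho> = 0") (auto simp: cone_class_def)
  qed (use that in blast)
qed

abbreviation circle_link :: "nat set \<Rightarrow> (complex \<times> nat) topology" where
  "circle_link F \<equiv> prod_topology (top_of_set (sphere 0 1)) (discrete_topology F)"

abbreviation apex :: "nat set \<Rightarrow> ((complex \<times> nat) \<times> real) set" where
  "apex F \<equiv> (sphere 0 1 \<times> F) \<times> {0}"

text \<open>The action moves a cone class by taking its image as a set of representatives; the apex
  is fixed because rotation permutes the circle.\<close>

lemma rotate_apex:
  assumes "norm s = 1"
  shows "(\<lambda>((c, f), r). ((s * c, f), r)) ` apex F = apex F"
proof
  show "(\<lambda>((c, f), r). ((s * c, f), r)) ` apex F \<subseteq> apex F"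
    using assms by (auto simp: norm_mult)
  show "apex F \<subseteq> (\<lambda>((c, f), r). ((s * c, f), r)) ` apex F"
  proof
    fix p assume "p \<in> apex F"
    then obtain c f where p: "p = ((c, f), 0)" "norm c = 1" "f \<in> F" by auto
    have "s \<noteq> 0" using assms by auto
    then have "p = (\<lambda>((c, f), r). ((s * c, f), r)) ((c / s, f), 0)" "((c / s, f), 0) \<in> apex F"
      using p assms by (auto simp: norm_divide)
    then show "p \<in> (\<lambda>((c, f), r). ((s * c, f), r)) ` apex F"
      by (rule image_eqI)
  qed
qed

text \<open>The apex is an equivalence class of its own and needs a separate clause: rotating all of its
  representatives to angle 1 would not give a class.\<close>

definition cone_fold :: "nat set \<Rightarrow> ((complex \<times> nat) \<times> real) set \<Rightarrow> ((complex \<times> nat) \<times> real) set" where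
  "cone_fold F c = (if c = apex F then apex F else (\<lambda>((z, f), r). ((1, f), r)) ` c)"

lemma not_apex: "\<rho> \<noteq> 0 \<Longrightarrow> {(p, \<rho>)} \<noteq> apex F"
  by auto

lemma cone_fold_point: "\<rho> \<noteq> 0 \<Longrightarrow> cone_fold F {((z, f), \<rho>)} = {((1, f), \<rho>)}"
  using not_apex[of \<rho> "(z, f)" F] by (simp add: cone_fold_def)

lemma continuous_map_cone_fold:
  "continuous_map (open_cone (circle_link F)) (open_cone (circle_link F)) (cone_fold F)"
proof (rule continuous_map_from_open_cone)
  let ?L = "circle_link F"
  let ?P = "prod_topology ?L (top_of_set {0..<1::real})"
  show "cone_fold F (topspace ?L \<times> {0}) \<in> topspace (open_cone ?L)"
    by (simp add: cone_fold_def topspace_open_cone)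
  \<comment> \<open>The folding on representatives, before passing to classes: the angle is reset to
    1. At radius 0 both composites give the apex, so the special clause of \<open>cone_fold\<close>
    agrees with it.\<close>
  let ?e = "\<lambda>p. ((1::complex, snd (fst p)), snd p)"
  have "continuous_map ?P ?P ?e"
    by (intro continuous_map_pairedI continuous_map_snd_of continuous_map_fst_of continuous_map_fst continuous_map_snd)
       (auto intro: continuous_map_compose[OF continuous_map_fst continuous_map_snd, unfolded o_def])
  then have "continuous_map ?P (open_cone ?L) (cone_class ?L \<circ> ?e)"
    using continuous_map_compose continuous_map_cone_class by blast
  moreover have "(cone_class ?L \<circ> ?e) p = (cone_fold F \<circ> cone_class ?L) p" for p
  proof -
    obtain z f \<rho> where "p = ((z, f), \<rho>)" by (metis surj_pair)
    then show ?thesis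
      by (cases "\<rho> = 0") (simp_all add: cone_class_def cone_fold_point, simp add: cone_fold_def)
  qed
  ultimately show "continuous_map ?P (open_cone ?L) (cone_fold F \<circ> cone_class ?L)"
    by (metis (no_types, lifting) continuous_map_eq)
qed

text \<open>These are the two section properties of the map \<open>(u, c)\<close> to
  \<open>(1, cone_fold F c)\<close> on the model: it stays in the orbit, and its value is constant
  along orbits.\<close>

lemma sing_model_fold:
  fixes u :: "complex ^ 'm"
  assumes "(u, c) \<in> topspace (sing_model i0 F)"
  shows "\<exists>s\<in>torus. sing_act i0 s (u, c) = (1, cone_fold F c)"
    and "s \<in> torus \<Longrightarrow> cone_fold F (snd (sing_act i0 s (u, c))) = cone_fold F c"
proof -
  have u: "u \<in> torus" "u $ i0 = 1" and c: "c \<in> topspace (open_cone (circle_link F))"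
    using assms by (auto simp: sing_model_def sub_torus_complement_def)
  have unz: "u $ j \<noteq> 0" "norm (u $ j) = 1" for j
    using u by (auto simp: torus_def) (metis norm_zero zero_neq_one)
  from c show "\<exists>s\<in>torus. sing_act i0 s (u, c) = (1, cone_fold F c)"
  proof (cases rule: topspace_open_cone_cases)
    case 1
    let ?s = "\<chi> j. inverse (u $ j)"
    have "?s \<in> torus"
      using unz by (simp add: torus_def norm_inverse)
    moreover have "sing_act i0 ?s (u, c) = (1, cone_fold F c)"
      using unz u 1 rotate_apex[of 1 F] by (simp add: sing_act_def vec_eq_iff cone_fold_def)
    ultimately show ?thesis by blast
  next
    case (2 p \<rho>)
    obtain z f where p: "p = (z, f)" by fastforce
    then have z: "norm z = 1" "z \<noteq> 0" using 2(2) by auto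
    \<comment> \<open>The factor \<open>u\<close> has coordinate 1 at \<open>i0\<close>, which
      leaves that coordinate of the torus free to undo the angle \<open>z\<close> of the cone
      point.\<close>
    let ?s = "\<chi> j. if j = i0 then inverse z else inverse (u $ j)"
    have "?s \<in> torus"
      using unz z by (simp add: torus_def norm_inverse)
    moreover have "sing_act i0 ?s (u, c) = (1, cone_fold F c)"
      using unz u z 2 p by (simp add: sing_act_def vec_eq_iff cone_fold_point)
    ultimately show ?thesis by blast
  qed
  assume s: "s \<in> torus"
  then have "norm (s $ i0) = 1" by (simp add: torus_def)
  from c show "cone_fold F (snd (sing_act i0 s (u, c))) = cone_fold F c"
  proof (cases rule: topspace_open_cone_cases)
    case 1
    then show ?thesis
      using rotate_apex[OF \<open>norm (s $ i0) = 1\<close>] by (simp add: sing_act_def)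
  next
    case (2 p \<rho>)
    then show ?thesis
      by (cases p) (simp add: sing_act_def cone_fold_point)
  qed
qed

context compact_torus_space begin

text \<open>The section is the folding of the model, transported by \<open>h\<close>. For the second
  claim, nontrivial stabilizers occur only over the apex, and the points over the apex form a single
  orbit; this is what isolates singular orbits.\<close>

lemma section_on_sing_chart:
  assumes U: "openin X U" "invariant_set act U"
    and \<phi>: "torus_aut \<phi>"
    and h: "homeomorphic_map (subtopology X U) (sing_model i0 F) h"
    and equiv: "\<forall>t\<in>torus. \<forall>y\<in>U. h (act t y) = sing_act i0 (\<phi> t) (h y)"
  shows "\<exists>q. section_on X act U q"
    and "y \<in> U \<Longrightarrow> z \<in> U \<Longrightarrow> stabilizer X act y \<noteq> {1} \<Longrightarrow> stabilizer X act z \<noteq> {1} \<Longrightarrow> z \<in> orbit act y"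
proof -
  let ?M = "sing_model i0 F" and ?C = "open_cone (circle_link F)"
  have Utop: "U \<subseteq> topspace X"
    using U openin_subset by blast
  then have [simp]: "topspace X \<inter> U = U" by auto
  obtain k where "homeomorphic_maps (subtopology X U) ?M h k"
    using h homeomorphic_map_maps by blast
  then have hcont: "continuous_map (subtopology X U) ?M h"
    and kcont: "continuous_map ?M (subtopology X U) k"
    and kh: "\<And>y. y \<in> U \<Longrightarrow> k (h y) = y" and hk: "\<And>v. v \<in> topspace ?M \<Longrightarrow> h (k v) = v"
    unfolding homeomorphic_maps_def by auto
  have hM: "h y \<in> topspace ?M" if "y \<in> U" for y
    using continuous_map_funspace[OF hcont] that by auto
  have kU: "k v \<in> U" if "v \<in> topspace ?M" for v
    using continuous_map_funspace[OF kcont] that by auto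
  \<comment> \<open>Motions in the model come from motions in \<open>U\<close> because
    \<open>\<phi>\<close> is onto the torus; orbit membership can thus be checked in the
    model.\<close>
  have reach: "\<exists>t\<in>torus. act t y = k (sing_act i0 s (h y))" if y: "y \<in> U" and s: "s \<in> torus" for y s
  proof -
    obtain t where t: "t \<in> torus" "\<phi> t = s"
      using torus_aut_surj[OF \<phi> s] by blast
    then have "k (h (act t y)) = act t y"
      using kh U(2) y by (simp add: invariant_set_def)
    then show ?thesis
      using equiv t y by metis
  qed
  define \<mu> where "\<mu> = (\<lambda>p :: (complex ^ 'm) \<times> _. (1 :: complex ^ 'm, cone_fold F (snd p)))"
  have one: "1 \<in> sub_torus_complement i0"
    by (simp add: sub_torus_complement_def torus_one)
  have "continuous_map ?M ?C (cone_fold F \<circ> snd)"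
    unfolding sing_model_def by (rule continuous_map_compose[OF continuous_map_snd continuous_map_cone_fold])
  then have \<mu>cont: "continuous_map ?M ?M \<mu>"
    using one unfolding \<mu>_def by (auto simp: sing_model_def o_def intro!: continuous_map_pairedI)
  define q where "q = k \<circ> \<mu> \<circ> h"
  have "continuous_map (subtopology X U) (subtopology X U) q"
    unfolding q_def by (intro continuous_map_compose[OF hcont] continuous_map_compose[OF \<mu>cont] kcont)
  then have qcont: "continuous_map (subtopology X U) X q"
    by (simp add: continuous_map_in_subtopology)
  have "q y \<in> orbit act y" if y: "y \<in> U" for y
  proof -
    obtain s where "s \<in> torus" "sing_act i0 s (h y) = \<mu> (h y)"
      using sing_model_fold(1)[of "fst (h y)" "snd (h y)" i0 F] hM[OF y] by (auto simp: \<mu>_def)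
    then obtain t where "t \<in> torus" "act t y = q y"
      using reach[OF y] by (metis q_def comp_apply)
    then show ?thesis
      using act_in_orbit by metis
  qed
  moreover have "q (act t y) = q y" if "t \<in> torus" "y \<in> U" for t y
  proof -
    have "\<mu> (h (act t y)) = \<mu> (h y)"
      using sing_model_fold(2)[of "fst (h y)" "snd (h y)" i0 F "\<phi> t"] hM[OF that(2)] equiv that
        torus_aut_in[OF \<phi> that(1)]
      by (simp add: \<mu>_def)
    then show ?thesis
      by (simp add: q_def)
  qed
  ultimately show "\<exists>q. section_on X act U q"
    unfolding section_on_def using qcont by blast
  have sing: "snd (h y) = apex F" if "y \<in> U" "stabilizer X act y \<noteq> {1}" for y
  proof -
    have c: "fst (h y) \<in> torus" "snd (h y) \<in> topspace ?C"
      using hM[OF that(1)] by (auto simp: sing_model_def sub_torus_complement_def)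
    from c(2) show ?thesis
    proof (cases rule: topspace_open_cone_cases)
      case 1
      then show ?thesis by simp
    next
      case (2 p \<rho>)
      \<comment> \<open>Off the apex all coordinates of \<open>\<phi> t\<close> are determined:
        those other than \<open>i0\<close> by the nonzero entries of the torus factor, and
        \<open>i0\<close> by the angle of the singleton class.\<close>
      have "t = 1" if t: "t \<in> torus" "act t y = y" for t
      proof (rule torus_aut_eq_one[OF \<phi> t(1)])
        have eq: "sing_act i0 (\<phi> t) (h y) = h y"
          using equiv t \<open>y \<in> U\<close> by metis
        have "fst (h y) $ j \<noteq> 0" for j
          using c(1) unfolding torus_def by (metis (mono_tags) mem_Collect_eq norm_zero zero_neq_one)
        then have "\<phi> t $ j = 1" if "j \<noteq> i0" for j
          using arg_cong[OF eq, of "\<lambda>p. fst p $ j"] that by (simp add: sing_act_def)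
        moreover have "\<phi> t $ i0 = 1"
        proof -
          obtain z f where p: "p = (z, f)" by fastforce
          then have "z \<noteq> 0" using 2(2) by auto
          then show ?thesis
            using arg_cong[OF eq, of snd] 2 p by (simp add: sing_act_def)
        qed
        ultimately show "\<phi> t = 1"
          by (simp add: vec_eq_iff) metis
      qed
      then have "stabilizer X act y = {1}"
        using torus_one act_one Utop \<open>y \<in> U\<close> by (auto simp: stabilizer_def)
      then show ?thesis using that by blast
    qed
  qed
  assume y: "y \<in> U" "stabilizer X act y \<noteq> {1}" and z: "z \<in> U" "stabilizer X act z \<noteq> {1}"
  \<comment> \<open>This matches the torus factors of the two points; its rotation of the cone does
    not matter, since both cone components are the fixed apex.\<close>
  define s where "s = (\<chi> j. fst (h z) $ j / fst (h y) $ j)"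
  have tor: "fst (h y) \<in> sub_torus_complement i0" if "y \<in> U" for y
    using hM[OF that] by (auto simp: sing_model_def)
  have nz: "fst (h y) $ j \<noteq> 0" for j
    using tor[OF y(1)] unfolding torus_def sub_torus_complement_def
    by (metis (mono_tags, lifting) mem_Collect_eq norm_zero zero_neq_one)
  have s: "s \<in> torus" "s $ i0 = 1"
    using tor[OF y(1)] tor[OF z(1)] by (simp_all add: s_def sub_torus_complement_def torus_def norm_divide)
  have "sing_act i0 s (h y) = h z"
  proof (rule prod_eqI)
    show "fst (sing_act i0 s (h y)) = fst (h z)"
      using nz tor[OF y(1)] tor[OF z(1)]
      by (simp add: sing_act_def vec_eq_iff s_def sub_torus_complement_def)
    show "snd (sing_act i0 s (h y)) = snd (h z)"
      using sing[OF y] sing[OF z] rotate_apex[of "s $ i0" F] s by (simp add: sing_act_def)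
  qed
  then obtain t where "t \<in> torus" "act t y = z"
    using reach[OF y(1) s(1)] kh[OF z(1)] by metis
  then show "z \<in> orbit act y"
    using act_in_orbit by metis
qed

end

section \<open>Existence of a global section\<close>

lemma locally_standard_compact_torus_space:
  "locally_standard_over_graph X act \<Longrightarrow> compact_torus_space X act"
  unfolding locally_standard_over_graph_def compact_torus_space_def by simp

locale graph_torus_space =
  fixes X :: "'a topology" and act :: "complex ^ 'm \<Rightarrow> 'a \<Rightarrow> 'a"
  assumes locally_standard: "locally_standard_over_graph X act"

sublocale graph_torus_space \<subseteq> compact_torus_space
  by (rule locally_standard_compact_torus_space[OF locally_standard])

context graph_torus_space begin

lemma free_chart:
  assumes "x \<in> free_part X act"
  obtains U i0 \<Omega> \<phi> h where "openin X U" "x \<in> U" "invariant_set act U"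
    "0 \<notin> \<Omega>" "\<forall>z\<in>\<Omega>. \<forall>c. norm c = 1 \<longrightarrow> c * z \<in> \<Omega>" "torus_aut \<phi>"
    "homeomorphic_map (subtopology X U) (top_of_set (free_model i0 \<Omega>)) h"
    "\<forall>t\<in>torus. \<forall>y\<in>U. h (act t y) = \<phi> t * h y"
proof -
  have "\<forall>x\<in>free_part X act. \<exists>U i0 \<Omega> \<phi> h.
        openin X U \<and> x \<in> U \<and> invariant_set act U \<and>
        open \<Omega> \<and> 0 \<notin> \<Omega> \<and> (\<forall>z\<in>\<Omega>. \<forall>c. norm c = 1 \<longrightarrow> c * z \<in> \<Omega>) \<and>
        torus_aut \<phi> \<and>
        homeomorphic_map (subtopology X U) (top_of_set (free_model i0 \<Omega>)) h \<and>
        (\<forall>t\<in>torus. \<forall>y\<in>U. h (act t y) = \<phi> t * h y)"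
    using locally_standard unfolding locally_standard_over_graph_def by (elim conjE)
  from bspec[OF this assms] show thesis
    by (elim exE conjE) (rule that)
qed

lemma sing_chart:
  assumes x: "x \<in> sing_part X act"
  obtains U where "openin X U" "x \<in> U" "invariant_set act U" "\<exists>q. section_on X act U q"
    "\<And>y. y \<in> U \<Longrightarrow> y \<in> sing_part X act \<Longrightarrow> y \<in> orbit act x"
proof -
  have "\<forall>x\<in>sing_part X act. \<exists>U i0 F \<phi> h.
        openin X U \<and> x \<in> U \<and> invariant_set act U \<and> finite F \<and>
        torus_aut \<phi> \<and>
        homeomorphic_map (subtopology X U) (sing_model i0 F) h \<and>
        (\<forall>t\<in>torus. \<forall>y\<in>U. h (act t y) = sing_act i0 (\<phi> t) (h y))"
    using locally_standard unfolding locally_standard_over_graph_def by (elim conjE)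
  from bspec[OF this x] obtain U i0 F \<phi> h where
    U: "openin X U" "x \<in> U" "invariant_set act U" and chart: "torus_aut \<phi>"
      "homeomorphic_map (subtopology X U) (sing_model i0 F) h"
      "\<forall>t\<in>torus. \<forall>y\<in>U. h (act t y) = sing_act i0 (\<phi> t) (h y)"
    by (elim exE conjE)
  show thesis
  proof (rule that[OF U section_on_sing_chart(1)[OF U(1,3) chart]])
    fix y assume "y \<in> U" "y \<in> sing_part X act"
    then show "y \<in> orbit act x"
      using section_on_sing_chart(2)[OF U(1,3) chart U(2)] x by (simp add: sing_part_def)
  qed
qed

text \<open>All coordinates are nonzero in a free model, so multiplication by the torus is free on
  it and the entire chart lies in the free part.\<close>

lemma openin_free_part: "openin X (free_part X act)"
proof (subst openin_subopen, intro ballI)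
  fix x assume "x \<in> free_part X act"
  then obtain U i0 \<Omega> \<phi> h where U: "openin X U" "x \<in> U" "invariant_set act U"
    and \<Omega>: "0 \<notin> \<Omega>" and \<phi>: "torus_aut \<phi>"
    and h: "homeomorphic_map (subtopology X U) (top_of_set (free_model i0 \<Omega>)) h"
    and equiv: "\<forall>t\<in>torus. \<forall>y\<in>U. h (act t y) = \<phi> t * h y"
    by (rule free_chart)
  have Utop: "U \<subseteq> topspace X"
    using U openin_subset by blast
  have "y \<in> free_part X act" if y: "y \<in> U" for y
  proof -
    have "h y \<in> free_model i0 \<Omega>"
      using continuous_map_funspace[OF homeomorphic_imp_continuous_map[OF h]] y Utop by auto
    then have nz: "h y $ j \<noteq> 0" for j
      using \<Omega> unfolding free_model_def by (cases "j = i0") auto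
    have "t = 1" if t: "t \<in> torus" "act t y = y" for t
    proof (rule torus_aut_eq_one[OF \<phi> t(1)])
      have "\<phi> t * h y = h y"
        using equiv t y by metis
      then show "\<phi> t = 1"
        using nz by (simp add: vec_eq_iff)
    qed
    then have "stabilizer X act y = {1}"
      using torus_one act_one Utop y by (auto simp: stabilizer_def)
    then show ?thesis
      using y Utop by (auto simp: free_part_def)
  qed
  then show "\<exists>T. openin X T \<and> x \<in> T \<and> T \<subseteq> free_part X act"
    using U by blast
qed

lemma sing_part_eq: "sing_part X act = topspace X - free_part X act"
  unfolding sing_part_def free_part_def by blast

lemma closedin_sing_part: "closedin X (sing_part X act)"
  unfolding sing_part_eq using openin_free_part by blast

text \<open>A is required to be a neighbourhood of its singular points, so that what is left to be covered
  afterwards is a compact subset of the free part.\<close>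

lemma section_near_finite_singular:
  assumes "finite S" "S \<subseteq> sing_part X act"
  shows "\<exists>A r W. closedin X A \<and> invariant_set act A \<and> section_on X act A r \<and>
    openin X W \<and> W \<subseteq> A \<and> sing_part X act \<inter> A \<subseteq> W \<and> S \<subseteq> A"
  using assms
proof (induction S rule: finite_induct)
  case empty
  have "section_on X act {} id"
    by (simp add: section_on_def continuous_map_on_empty)
  then show ?case
    by (intro exI[of _ "{}"] exI[of _ id]) (simp add: invariant_set_def del: id_apply)
next
  case (insert x S)
  then obtain A r W where A: "closedin X A" "invariant_set act A" "section_on X act A r"
    and W: "openin X W" "W \<subseteq> A" "sing_part X act \<inter> A \<subseteq> W" "S \<subseteq> A"
    by auto
  show ?case
  proof (cases "x \<in> A")
    case True
    then show ?thesis
      using A W by blast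
  next
    case False
    have "x \<in> sing_part X act" using insert.prems by simp
    then obtain U where U: "openin X U" "x \<in> U" "invariant_set act U" "\<exists>q. section_on X act U q"
      and orb: "\<And>y. y \<in> U \<Longrightarrow> y \<in> sing_part X act \<Longrightarrow> y \<in> orbit act x"
      by (rule sing_chart) blast
    \<comment> \<open>A missed singular orbit lies off the closed invariant set \<open>A\<close>, so
      its neighbourhood \<open>C\<close> can be chosen disjoint from \<open>A\<close>. The agreement
      condition for pasting is then vacuous.\<close>
    have "invariant_set act (U - A)"
      unfolding invariant_set_def
    proof (intro ballI)
      fix t :: "complex ^ 'm" and y assume t: "t \<in> torus" and y: "y \<in> U - A"
      obtain s where "s \<in> torus" "act s (act t y) = y"
        using act_inverse[OF t] y openin_subset[OF U(1)] by (metis DiffD1 subsetD)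
      then show "act t y \<in> U - A"
        using y t U(3) A(2) unfolding invariant_set_def by (metis Diff_iff)
    qed
    moreover have "openin X (U - A)" "x \<in> U - A"
      using U A False by auto
    ultimately obtain V C where V: "openin X V" "invariant_set act V" "x \<in> V" "V \<subseteq> C"
      and C: "closedin X C" "invariant_set act C" "C \<subseteq> U - A"
      using invariant_closed_neighbourhood by metis
    obtain q where "section_on X act U q" using U(4) by blast
    then have q: "section_on X act C q"
      using section_on_subset C(3) by blast
    have "section_on X act (A \<union> C) (\<lambda>x. if x \<in> A then r x else q x)"
      by (rule section_on_Un[OF A(1,2) C(1) A(3) q _ C(2)]) (use C(3) in blast)
    \<comment> \<open>The only singular points of \<open>C\<close> are those of the orbit of
      \<open>x\<close>, because \<open>C\<close> lies in \<open>U\<close>; the invariant set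
      \<open>V\<close> contains that orbit.\<close>
    moreover have "sing_part X act \<inter> (A \<union> C) \<subseteq> W \<union> V"
      using W(3) orb C(3) invariant_orbit_subset[OF V(2,3)] by blast
    moreover have "closedin X (A \<union> C)" "openin X (W \<union> V)" "W \<union> V \<subseteq> A \<union> C" "insert x S \<subseteq> A \<union> C"
      using A C W V by auto
    moreover have "invariant_set act (A \<union> C)"
      using A(2) C(2) unfolding invariant_set_def by blast
    ultimately show ?thesis by blast
  qed
qed

text \<open>The singular part is closed, hence compact, and is covered by open sets that each meet a
  single singular orbit. So there are finitely many such orbits, and one representative of each puts
  the whole orbit into the invariant set \<open>A\<close>.\<close>

lemma section_near_singular:
  obtains A r W where "closedin X A" "invariant_set act A" "section_on X act A r"
    "openin X W" "W \<subseteq> A" "sing_part X act \<subseteq> W"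
proof -
  define N where "N x U \<longleftrightarrow> openin X U \<and> x \<in> U \<and>
    (\<forall>y. y \<in> U \<longrightarrow> y \<in> sing_part X act \<longrightarrow> y \<in> orbit act x)" for x U
  have N: "\<exists>U. N x U" if "x \<in> sing_part X act" for x
    using sing_chart[OF that] unfolding N_def by metis
  have comp: "compactin X (sing_part X act)"
    using closedin_compact_space[OF compact closedin_sing_part] .
  have cover: "sing_part X act \<subseteq> \<Union>{U. \<exists>x\<in>sing_part X act. N x U}"
    using N unfolding N_def by blast
  have ope: "openin X U" if "U \<in> {U. \<exists>x\<in>sing_part X act. N x U}" for U
    using that unfolding N_def by blast
  obtain \<F> where \<F>: "finite \<F>" "\<F> \<subseteq> {U. \<exists>x\<in>sing_part X act. N x U}"
      "sing_part X act \<subseteq> \<Union>\<F>"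
    using compactinD[OF comp _ cover] ope by blast
  have "\<forall>U\<in>\<F>. \<exists>x\<in>sing_part X act. N x U"
    using \<F>(2) by blast
  then obtain p where p: "\<And>U. U \<in> \<F> \<Longrightarrow> p U \<in> sing_part X act" "\<And>U. U \<in> \<F> \<Longrightarrow> N (p U) U"
    by metis
  have fin: "finite (p ` \<F>)" "p ` \<F> \<subseteq> sing_part X act"
    using \<F>(1) p(1) by auto
  from section_near_finite_singular[OF fin] obtain A r W
    where A: "closedin X A" "invariant_set act A" "section_on X act A r"
    and W: "openin X W" "W \<subseteq> A" "sing_part X act \<inter> A \<subseteq> W" "p ` \<F> \<subseteq> A"
    by (elim exE conjE)
  have "sing_part X act \<subseteq> A"
  proof
    fix y assume y: "y \<in> sing_part X act"
    then obtain U where U: "U \<in> \<F>" "y \<in> U" using \<F>(3) by blast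
    then have "y \<in> orbit act (p U)"
      using p(2) y unfolding N_def by blast
    then show "y \<in> A"
      using invariant_orbit_subset[OF A(2), of "p U"] W(4) U(1) by blast
  qed
  then have "sing_part X act \<subseteq> W"
    using W(3) by blast
  then show thesis
    using that A W by blast
qed

lemma section_exists: "\<exists>r. section_on X act (topspace X) r"
proof -
  obtain A r W where A: "closedin X A" "invariant_set act A" "section_on X act A r"
    and W: "openin X W" "W \<subseteq> A" "sing_part X act \<subseteq> W"
    by (rule section_near_singular)
  \<comment> \<open>Extendability is required over every closed invariant \<open>A\<close>, since
    the set already covered grows during the induction. What is added is a closed \<open>C\<close>
    around \<open>V\<close>: open sets serve compactness, closed ones pasting.\<close>
  define E where "E V \<longleftrightarrow> openin X V \<and> (\<exists>C. V \<subseteq> C \<and> closedin X C \<and> invariant_set act C \<and>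
    (\<forall>A r. closedin X A \<longrightarrow> invariant_set act A \<longrightarrow> section_on X act A r \<longrightarrow>
      (\<exists>r'. section_on X act (A \<union> C) r')))" for V
  have E: "\<exists>V. E V \<and> x \<in> V" if x: "x \<in> free_part X act" for x
  proof -
    obtain U i0 \<Omega> \<phi> h where U: "openin X U" "x \<in> U" "invariant_set act U"
      and chart: "0 \<notin> \<Omega>" "\<forall>z\<in>\<Omega>. \<forall>c. norm c = 1 \<longrightarrow> c * z \<in> \<Omega>" "torus_aut \<phi>"
        "homeomorphic_map (subtopology X U) (top_of_set (free_model i0 \<Omega>)) h"
        "\<forall>t\<in>torus. \<forall>y\<in>U. h (act t y) = \<phi> t * h y"
      using x by (rule free_chart)
    obtain V C where V: "openin X V" "x \<in> V" "V \<subseteq> C"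
      and C: "closedin X C" "invariant_set act C" "C \<subseteq> U"
      using invariant_closed_neighbourhood[OF U(1,3,2)] by metis
    have "\<exists>r'. section_on X act (A \<union> C) r'"
      if "closedin X A" "invariant_set act A" "section_on X act A r" for A r
      using section_on_free_chart[OF that C U(1,3) chart] by metis
    then have "E V"
      unfolding E_def using V C by blast
    then show ?thesis using V by blast
  qed
  have "closedin X (topspace X - W)"
    using W(1) by blast
  then have "compactin X (topspace X - W)"
    using closedin_compact_space[OF compact] by blast
  moreover have "topspace X - W \<subseteq> \<Union>{V. E V}"
    using E W(3) unfolding sing_part_eq by blast
  moreover have "\<And>V. V \<in> {V. E V} \<Longrightarrow> openin X V"
    by (simp add: E_def)
  ultimately obtain \<F> where \<F>: "finite \<F>" "\<F> \<subseteq> {V. E V}" "topspace X - W \<subseteq> \<Union>\<F>"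
    using compactinD by metis
  have "\<exists>A' r'. closedin X A' \<and> invariant_set act A' \<and> section_on X act A' r' \<and> A \<subseteq> A' \<and> \<Union>\<F> \<subseteq> A'"
    using \<F>(1,2)
  proof (induction \<F> rule: finite_induct)
    case empty
    then show ?case using A by (intro exI[of _ A] exI[of _ r]) simp
  next
    case (insert V \<F>)
    then obtain A' r' where A': "closedin X A'" "invariant_set act A'" "section_on X act A' r'"
        "A \<subseteq> A'" "\<Union>\<F> \<subseteq> A'"
      by auto
    have "E V" using insert.prems by simp
    then obtain C where C: "V \<subseteq> C" "closedin X C" "invariant_set act C"
      and "\<forall>A r. closedin X A \<longrightarrow> invariant_set act A \<longrightarrow> section_on X act A r \<longrightarrow>
        (\<exists>r'. section_on X act (A \<union> C) r')"
      unfolding E_def by (elim conjE exE)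
    then obtain r'' where r'': "section_on X act (A' \<union> C) r''"
      using A'(1-3) by (metis (no_types))
    moreover have "closedin X (A' \<union> C)" "invariant_set act (A' \<union> C)"
      using A'(1,2) C by (auto simp: invariant_set_def)
    moreover have "A \<subseteq> A' \<union> C" "\<Union>(insert V \<F>) \<subseteq> A' \<union> C"
      using A'(4,5) C(1) by auto
    ultimately show ?case by (intro exI[of _ "A' \<union> C"] exI[of _ r'']) simp
  qed
  then obtain A' r' where "section_on X act A' r'" "A \<subseteq> A'" "\<Union>\<F> \<subseteq> A'"
    by (elim exE conjE)
  moreover have "topspace X \<subseteq> A'"
    using \<open>A \<subseteq> A'\<close> \<open>\<Union>\<F> \<subseteq> A'\<close> W(2) \<F>(3) by blast
  ultimately have "section_on X act (topspace X) r'"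
    by (metis section_on_subset)
  then show ?thesis
    by (intro exI[of _ r'])
qed

end

section \<open>Strata and stabilizers\<close>

lemma torus_divide:
  assumes "s \<in> torus" "t \<in> torus"
  obtains d where "d \<in> torus" "t = s * d"
proof -
  obtain u where u: "u \<in> torus" "u * s = 1"
    using torus_inverse[OF assms(1)] by metis
  have "s * (u * t) = (u * s) * t"
    by (simp add: mult.left_commute mult.assoc)
  then have "t = s * (u * t)"
    using u(2) by simp
  then show thesis
    using that torus_mult[OF u(1) assms(2)] by metis
qed

lemma quotient_map_orbit: "quotient_map X (orbit_space X act) (orbit act)"
  unfolding orbit_space_def by (rule quotient_map_quotient_topology)

lemma topspace_orbit_space: "topspace (orbit_space X act) = orbit act ` topspace X"
  unfolding orbit_space_def by (rule topspace_quotient_topology)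

context graph_torus_space begin

lemma sing_part_subset: "sing_part X act \<subseteq> topspace X"
  unfolding sing_part_def by blast

lemma orbit_space_Q0_subset: "orbit_space_Q0 X act \<subseteq> topspace (orbit_space X act)"
  unfolding orbit_space_Q0_def topspace_orbit_space using sing_part_subset by blast

lemma orbit_in_image_iff:
  assumes "invariant_set act U" "U \<subseteq> topspace X" "x \<in> topspace X"
  shows "orbit act x \<in> orbit act ` U \<longleftrightarrow> x \<in> U"
proof
  assume "orbit act x \<in> orbit act ` U"
  then obtain y where "y \<in> U" "orbit act x = orbit act y" by (rule imageE)
  then show "x \<in> U"
    using orbit_self[OF assms(3)] invariant_orbit_subset[OF assms(1)] by (metis subsetD)
qed (rule imageI)

text \<open>A singular chart contains one singular orbit and is saturated, so its image is an open
  set of orbits meeting \<open>orbit_space_Q0 X act\<close> in one point. Strata in the singular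
  part are therefore points.\<close>

lemma discrete_orbit_space_Q0:
  "subtopology (orbit_space X act) (orbit_space_Q0 X act) = discrete_topology (orbit_space_Q0 X act)"
proof -
  let ?Q = "orbit_space X act" and ?Z = "orbit_space_Q0 X act"
  have "openin (subtopology ?Q ?Z) {q}" if q: "q \<in> ?Z" for q
  proof -
    obtain x where x: "x \<in> sing_part X act" "q = orbit act x"
      using q unfolding orbit_space_Q0_def by (rule imageE)
    obtain U where U: "openin X U" "x \<in> U" "invariant_set act U"
      and orb: "\<And>y. y \<in> U \<Longrightarrow> y \<in> sing_part X act \<Longrightarrow> y \<in> orbit act x"
      using x(1) by (rule sing_chart) metis
    have Utop: "U \<subseteq> topspace X"
      using openin_subset[OF U(1)] .
    have "{p \<in> topspace X. orbit act p \<in> orbit act ` U} = U"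
      using orbit_in_image_iff[OF U(3) Utop] Utop by (auto simp: subset_iff)
    then have V: "openin ?Q (orbit act ` U)"
      unfolding orbit_space_def openin_quotient_topology using U(1) Utop image_mono by metis
    have "orbit act ` U \<inter> ?Z = {q}"
    proof
      show "orbit act ` U \<inter> ?Z \<subseteq> {q}"
      proof
        fix p assume p: "p \<in> orbit act ` U \<inter> ?Z"
        then obtain y where y: "y \<in> sing_part X act" "p = orbit act y"
          unfolding orbit_space_Q0_def by blast
        then have "y \<in> U"
          using p orbit_in_image_iff[OF U(3) Utop, of y] sing_part_subset by auto
        then have "y \<in> orbit act x"
          using orb y(1) by simp
        then show "p \<in> {q}"
          using orbit_eq[of x y] x y sing_part_subset by auto
      qed
      show "{q} \<subseteq> orbit act ` U \<inter> ?Z"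
        using q x(2) U(2) by simp
    qed
    then show ?thesis
      using V unfolding openin_subtopology by metis
  qed
  moreover have "topspace (subtopology ?Q ?Z) = ?Z"
    using orbit_space_Q0_subset by (simp add: Int_absorb1)
  ultimately show ?thesis
    using discrete_topology_unique[of ?Z "subtopology ?Q ?Z"] by simp
qed

text \<open>A stratum of singular orbits is one orbit, by discreteness; over the other strata all
  stabilizers are trivial. This makes the characteristic function meaningful.\<close>

lemma stabilizer_constant_on_strata:
  assumes S: "S \<in> strata X act" and x: "x \<in> topspace X" "orbit act x \<in> S"
    and y: "y \<in> topspace X" "orbit act y \<in> S"
  shows "stabilizer X act x = stabilizer X act y"
proof -
  let ?Q = "orbit_space X act" and ?Z = "orbit_space_Q0 X act"
  consider "S \<in> connected_components_of (subtopology ?Q ?Z)"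
    | "S \<in> connected_components_of (subtopology ?Q (topspace ?Q - ?Z))"
    using S unfolding strata_def by blast
  then show ?thesis
  proof cases
    case 1
    then have "orbit act x = orbit act y"
      using x y unfolding discrete_orbit_space_Q0 connected_components_of_discrete_topology by auto
    then have "x \<in> orbit act y"
      using orbit_self[OF x(1)] by simp
    then show ?thesis
      using stabilizer_orbit[OF y(1)] by simp
  next
    case 2
    then have "S \<subseteq> topspace ?Q - ?Z"
      using connected_components_of_subset by fastforce
    then have "stabilizer X act z = {1}" if "z \<in> topspace X" "orbit act z \<in> S" for z
      using that unfolding orbit_space_Q0_def sing_part_def by blast
    then show ?thesis
      using x y by simp
  qed
qed

text \<open>Constancy gives existence for the definite description, and the point \<open>x\<close>
  over \<open>S\<close> gives uniqueness.\<close>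

lemma char_fun_eq_stabilizer:
  assumes "S \<in> strata X act" "x \<in> topspace X" "orbit act x \<in> S"
  shows "char_fun X act S = stabilizer X act x"
  unfolding char_fun_def
proof (rule the_equality)
  show "\<forall>y\<in>topspace X. orbit act y \<in> S \<longrightarrow> stabilizer X act y = stabilizer X act x"
    using stabilizer_constant_on_strata[OF assms(1) _ _ assms(2,3)] by simp
qed (use assms(2,3) in simp)

lemma orbit_in_stratum:
  assumes "x \<in> topspace X"
  obtains S where "S \<in> strata X act" "orbit act x \<in> S"
proof -
  let ?Q = "orbit_space X act" and ?Z = "orbit_space_Q0 X act"
  have "orbit act x \<in> topspace ?Q"
    using assms by (simp add: topspace_orbit_space)
  then have "orbit act x \<in> topspace (subtopology ?Q ?Z) \<union> topspace (subtopology ?Q (topspace ?Q - ?Z))"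
    by auto
  then have "orbit act x \<in> \<Union>(strata X act)"
    unfolding strata_def by (simp only: Union_Un_distrib Union_connected_components_of)
  then show thesis
    using that by blast
qed

lemma stratum_nonempty:
  assumes "S \<in> strata X act"
  obtains x where "x \<in> topspace X" "orbit act x \<in> S"
proof -
  have "S \<noteq> {}"
    using assms nonempty_connected_components_of unfolding strata_def by blast
  moreover have "S \<subseteq> topspace (orbit_space X act)"
    using assms connected_components_of_subset unfolding strata_def by fastforce
  ultimately show thesis
    using that unfolding topspace_orbit_space by blast
qed

lemma section_constant:
  assumes "section_on X act (topspace X) r" "x \<in> topspace X" "y \<in> topspace X" "orbit act x = orbit act y"
  shows "r x = r y"
proof -
  have "x \<in> orbit act y"
    using orbit_self[OF assms(2)] assms(4) by simp
  then obtain t where "t \<in> torus" "x = act t y" by (rule orbitE)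
  then show ?thesis
    using assms(1,3) unfolding section_on_def by metis
qed

lemma section_in:
  assumes "section_on X act (topspace X) r" "x \<in> topspace X"
  shows "r x \<in> topspace X" "orbit act (r x) = orbit act x"
proof -
  have "r x \<in> orbit act x"
    using assms unfolding section_on_def by simp
  then show "r x \<in> topspace X" "orbit act (r x) = orbit act x"
    using orbit_subset[OF assms(2)] orbit_eq[OF assms(2)] by auto
qed

lemma section_continuous: "section_on X act (topspace X) r \<Longrightarrow> continuous_map X X r"
  unfolding section_on_def by simp

end

section \<open>Comparison of characteristic data and torus spaces\<close>

lemma stratified_homeo_imp_equivariant:
  fixes X :: "'a topology" and act :: "complex ^ 'm \<Rightarrow> 'a \<Rightarrow> 'a"
    and X' :: "'b topology" and act' :: "complex ^ 'm \<Rightarrow> 'b \<Rightarrow> 'b"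
  assumes "graph_torus_space X act" "graph_torus_space X' act'"
    and f: "stratified_homeo X act X' act' f" and \<psi>: "torus_aut \<psi>"
    and char: "\<forall>S\<in>strata X act. \<psi> ` char_fun X act S = char_fun X' act' (f ` S)"
  shows "\<exists>F. homeomorphic_map X X' F \<and> (\<forall>t\<in>torus. \<forall>x\<in>topspace X. F (act t x) = act' (\<psi> t) (F x))"
proof -
  interpret X: graph_torus_space X act by fact
  interpret X': graph_torus_space X' act' by fact
  let ?Q = "orbit_space X act" and ?Q' = "orbit_space X' act'"
  obtain r where r: "section_on X act (topspace X) r"
    using X.section_exists by (elim exE)
  obtain r' where r': "section_on X' act' (topspace X') r'"
    using X'.section_exists by (elim exE)
  have homeo: "homeomorphic_map ?Q ?Q' f"
    using f by (simp add: stratified_homeo_def)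
  have stab: "stabilizer X' act' x' = \<psi> ` stabilizer X act x"
    if x: "x \<in> topspace X" "x' \<in> topspace X'" "orbit act' x' = f (orbit act x)" for x x'
  proof -
    obtain S where S: "S \<in> strata X act" "orbit act x \<in> S"
      using X.orbit_in_stratum[OF x(1)] by metis
    then have S': "f ` S \<in> strata X' act'" "orbit act' x' \<in> f ` S"
      using f x(3) by (simp_all add: stratified_homeo_def)
    show ?thesis
      using bspec[OF char S(1)] X.char_fun_eq_stabilizer[OF S(1) x(1) S(2)] X'.char_fun_eq_stabilizer[OF S'(1) x(2) S'(2)]
      by simp
  qed
  \<comment> \<open>Being constant on orbits, \<open>r'\<close> descends to a genuine section of the
    orbit map, which can be composed with \<open>f\<close>.\<close>
  obtain s' where s': "continuous_map ?Q' X' s'"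
    and s'_orbit: "\<And>x. x \<in> topspace X' \<Longrightarrow> s' (orbit act' x) = r' x"
    by (rule quotient_map_lift_exists[OF quotient_map_orbit[of X' act'] X'.section_continuous[OF r']])
       (erule (2) X'.section_constant[OF r'], rule that)
  define \<sigma> where "\<sigma> = s' \<circ> f \<circ> orbit act"
  have \<sigma>cont: "continuous_map X X' \<sigma>"
    unfolding \<sigma>_def
    by (intro continuous_map_compose[OF quotient_imp_continuous_map[OF quotient_map_orbit]]
        continuous_map_compose[OF homeomorphic_imp_continuous_map[OF homeo]] s')
  have \<sigma>: "\<sigma> x \<in> topspace X'" "orbit act' (\<sigma> x) = f (orbit act x)" if x: "x \<in> topspace X" for x
  proof -
    have "f (orbit act x) \<in> topspace ?Q'"
      using homeomorphic_imp_surjective_map[OF homeo] x topspace_orbit_space by (metis imageI)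
    then obtain x' where x': "x' \<in> topspace X'" "f (orbit act x) = orbit act' x'"
      unfolding topspace_orbit_space by (elim imageE)
    then have "\<sigma> x = r' x'"
      using s'_orbit by (simp add: \<sigma>_def)
    then show "\<sigma> x \<in> topspace X'" "orbit act' (\<sigma> x) = f (orbit act x)"
      using X'.section_in[OF r' x'(1)] x'(2) by simp_all
  qed
  have \<sigma>_eq: "\<sigma> x = \<sigma> y" if "orbit act x = orbit act y" for x y
    using that by (simp add: \<sigma>_def)
  \<comment> \<open>\<open>X\<close> stands in for the orbit space as second factor:
    \<open>r\<close> and \<open>\<sigma>\<close> are constant on orbits, so \<open>a\<close> and
    \<open>b\<close> see only the orbit of the second argument.\<close>
  let ?P = "prod_topology (top_of_set (torus :: (complex ^ 'm) set)) X"
  define a where "a = (\<lambda>p. act (fst p) (r (snd p)))"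
  define b where "b = (\<lambda>p. act' (\<psi> (fst p)) (\<sigma> (snd p)))"
  have "continuous_map ?P ?P (\<lambda>p. (fst p, r (snd p)))"
    by (intro continuous_map_pairedI continuous_map_fst
        continuous_map_compose[OF continuous_map_snd X.section_continuous[OF r], unfolded o_def])
  from continuous_map_compose[OF this X.continuous_act] have acont: "continuous_map ?P X a"
    by (simp add: o_def a_def)
  have "continuous_map (top_of_set torus) (top_of_set torus) \<psi>"
    using torus_aut_continuous[OF \<psi>] torus_aut_in[OF \<psi>] by (simp add: continuous_map_in_subtopology image_subset_iff)
  then have "continuous_map ?P (prod_topology (top_of_set torus) X') (\<lambda>p. (\<psi> (fst p), \<sigma> (snd p)))"
    by (intro continuous_map_pairedI
        continuous_map_compose[OF continuous_map_fst, unfolded o_def]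
        continuous_map_compose[OF continuous_map_snd \<sigma>cont, unfolded o_def])
  from continuous_map_compose[OF this X'.continuous_act] have bcont: "continuous_map ?P X' b"
    by (simp add: o_def b_def)
  have a_orbit: "orbit act (a (t, x)) = orbit act x" if "t \<in> torus" "x \<in> topspace X" for t x
    using X.orbit_act[OF that(1) X.section_in(1)[OF r that(2)]] X.section_in(2)[OF r that(2)] by (simp add: a_def)
  have b_orbit: "orbit act' (b (t, x)) = f (orbit act x)" if "t \<in> torus" "x \<in> topspace X" for t x
    using X'.orbit_act[OF torus_aut_in[OF \<psi> that(1)] \<sigma>(1)[OF that(2)]] \<sigma>(2)[OF that(2)] by (simp add: b_def)
  have a_in: "a (t, x) \<in> topspace X" if "t \<in> torus" "x \<in> topspace X" for t x
    using X.act_in[OF that(1) X.section_in(1)[OF r that(2)]] by (simp add: a_def)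
  have a_repr: "\<exists>t\<in>torus. x = a (t, x)" if x: "x \<in> topspace X" for x
  proof -
    have "x \<in> orbit act (r x)"
      using X.orbit_self[OF x] X.section_in(2)[OF r x] by simp
    then show ?thesis
      unfolding orbit_def a_def by auto
  qed
  \<comment> \<open>Both actions identify parameters in the same way, because \<psi> matches the stabilizers.\<close>
  have ab_iff: "a (t, x) = a (s, y) \<longleftrightarrow> b (t, x) = b (s, y)"
    if t: "t \<in> torus" and s: "s \<in> torus" and x: "x \<in> topspace X" and y: "y \<in> topspace X"
      and xy: "orbit act x = orbit act y" for t s x y
  proof -
    obtain d where d: "d \<in> torus" "t = s * d"
      using torus_divide[OF s t] by metis
    have rx: "r x \<in> topspace X" "orbit act (r x) = orbit act x"
      using X.section_in[OF r x] by auto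
    have "a (t, x) = a (s, y) \<longleftrightarrow> act d (r x) = r x"
      using X.act_translate_iff[OF s d(1) rx(1)] X.section_constant[OF r x y xy] d(2) by (simp add: a_def)
    also have "\<dots> \<longleftrightarrow> d \<in> stabilizer X act (r x)"
      using d(1) by (simp add: stabilizer_def)
    also have "\<dots> \<longleftrightarrow> \<psi> d \<in> \<psi> ` stabilizer X act (r x)"
      using inj_on_image_mem_iff[OF torus_aut_inj[OF \<psi>] d(1), of "stabilizer X act (r x)"]
      by (simp add: stabilizer_def)
    also have "\<dots> \<longleftrightarrow> \<psi> d \<in> stabilizer X' act' (\<sigma> x)"
      using stab[OF rx(1) \<sigma>(1)[OF x]] \<sigma>(2)[OF x] rx(2) by simp
    also have "\<dots> \<longleftrightarrow> act' (\<psi> d) (\<sigma> x) = \<sigma> x"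
      using torus_aut_in[OF \<psi> d(1)] by (simp add: stabilizer_def)
    also have "\<dots> \<longleftrightarrow> b (t, x) = b (s, y)"
      using X'.act_translate_iff[OF torus_aut_in[OF \<psi> s] torus_aut_in[OF \<psi> d(1)] \<sigma>(1)[OF x]]
        \<sigma>_eq[OF xy] d(2) torus_aut_mult[OF \<psi> s d(1)] by (simp add: b_def)
    finally show ?thesis .
  qed
  \<comment> \<open>Compactness of \<open>?P\<close> and the Hausdorff property of \<open>X\<close>
    make the surjection \<open>a\<close> a quotient map, through which \<open>b\<close> factors as
    \<open>F\<close>.\<close>
  have "compact_space (top_of_set (torus :: (complex ^ 'm) set))"
    by (rule compact_space_subtopology) (simp add: compact_torus)
  then have P_comp: "compact_space ?P"
    using X.compact by (simp add: compact_space_prod_topology)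
  have a_surj: "a ` topspace ?P = topspace X"
  proof
    show "a ` topspace ?P \<subseteq> topspace X"
      using continuous_map_image_subset_topspace[OF acont] .
    show "topspace X \<subseteq> a ` topspace ?P"
      using a_repr by fastforce
  qed
  have compat: "b p = b q" if "p \<in> topspace ?P" "q \<in> topspace ?P" "a p = a q" for p q
  proof -
    obtain t x s y where pq: "p = (t, x)" "q = (s, y)" by (metis surj_pair)
    then have *: "t \<in> torus" "s \<in> torus" "x \<in> topspace X" "y \<in> topspace X"
      using that by auto
    moreover have "orbit act x = orbit act y"
      using a_orbit[OF *(1,3)] a_orbit[OF *(2,4)] that(3) pq by simp
    ultimately show ?thesis
      using ab_iff that(3) pq by simp
  qed
  obtain F where Fcont: "continuous_map X X' F" and Fim: "F ` topspace X = b ` topspace ?P"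
    and Fa: "\<And>p. p \<in> topspace ?P \<Longrightarrow> F (a p) = b p"
    by (rule quotient_map_lift_exists[OF continuous_imp_quotient_map[OF acont P_comp X.Hausdorff a_surj] bcont])
       (erule (2) compat, rule that)
  have Fb: "F (a (t, x)) = b (t, x)" if "t \<in> torus" "x \<in> topspace X" for t x
    using Fa[of "(t, x)"] that by simp
  have "topspace X' \<subseteq> b ` topspace ?P"
  proof
    fix x' assume x': "x' \<in> topspace X'"
    then have "orbit act' x' \<in> f ` topspace ?Q"
      using homeomorphic_imp_surjective_map[OF homeo] topspace_orbit_space by (metis imageI)
    then obtain x where x: "x \<in> topspace X" "orbit act' x' = f (orbit act x)"
      unfolding topspace_orbit_space by (elim imageE) simp
    then have "x' \<in> orbit act' (\<sigma> x)"
      using X'.orbit_self[OF x'] \<sigma>(2) by simp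
    then obtain u where u: "u \<in> torus" "x' = act' u (\<sigma> x)" by (rule X'.orbitE)
    then obtain t where "t \<in> torus" "\<psi> t = u"
      using torus_aut_surj[OF \<psi>] by metis
    then have "x' = b (t, x)" "(t, x) \<in> topspace ?P"
      using u x by (simp_all add: b_def)
    then show "x' \<in> b ` topspace ?P" by (rule image_eqI)
  qed
  then have Fsurj: "F ` topspace X = topspace X'"
    using Fim continuous_map_image_subset_topspace[OF bcont] by simp
  have Finj: "inj_on F (topspace X)"
  proof (rule inj_onI)
    fix x y assume x: "x \<in> topspace X" and y: "y \<in> topspace X" and eq: "F x = F y"
    obtain t where t: "t \<in> torus" "x = a (t, x)" using a_repr[OF x] by (elim bexE)
    obtain s where s: "s \<in> torus" "y = a (s, y)" using a_repr[OF y] by (elim bexE)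
    have b: "b (t, x) = b (s, y)"
      using Fb[OF t(1) x] Fb[OF s(1) y] eq unfolding t(2)[symmetric] s(2)[symmetric] by simp
    \<comment> \<open>\<open>ab_iff\<close> compares parameters over one and the same orbit only, so
      the orbits are first shown equal by injectivity of \<open>f\<close>.\<close>
    then have "f (orbit act x) = f (orbit act y)"
      using b_orbit[OF t(1) x] b_orbit[OF s(1) y] by simp
    then have "orbit act x = orbit act y"
      by (rule inj_onD[OF homeomorphic_imp_injective_map[OF homeo]]) (simp_all add: topspace_orbit_space x y)
    then have "a (t, x) = a (s, y)"
      using ab_iff[OF t(1) s(1) x y] b by simp
    then show "x = y"
      unfolding t(2)[symmetric] s(2)[symmetric] .
  qed
  have "F (act t x) = act' (\<psi> t) (F x)" if t: "t \<in> torus" and x: "x \<in> topspace X" for t x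
  proof -
    obtain u where u: "u \<in> torus" "x = a (u, x)" using a_repr[OF x] by (elim bexE)
    have "act t (a (u, x)) = a (t * u, x)"
      using X.act_mult[OF t u(1) X.section_in(1)[OF r x]] by (simp add: a_def)
    moreover have "act' (\<psi> t) (b (u, x)) = b (t * u, x)"
      using X'.act_mult[OF torus_aut_in[OF \<psi> t] torus_aut_in[OF \<psi> u(1)] \<sigma>(1)[OF x]]
        torus_aut_mult[OF \<psi> t u(1)] by (simp add: b_def)
    ultimately show ?thesis
      using Fb[OF u(1) x] Fb[OF torus_mult[OF t u(1)] x] unfolding u(2)[symmetric] by simp
  qed
  moreover have "homeomorphic_map X X' F"
    by (rule continuous_imp_homeomorphic_map[OF Fcont X.compact X'.Hausdorff Fsurj Finj])
  ultimately show ?thesis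
    by (intro exI[of _ F]) simp
qed

lemma orbit_image:
  assumes "torus_aut \<psi>" "x \<in> topspace X"
    and "\<And>t x. t \<in> torus \<Longrightarrow> x \<in> topspace X \<Longrightarrow> F (act t x) = act' (\<psi> t) (F x)"
  shows "F ` orbit act x = orbit act' (F x)"
proof -
  have "F ` orbit act x = (\<lambda>t. act' (\<psi> t) (F x)) ` torus"
    unfolding orbit_def image_image by (rule image_cong) (simp_all add: assms(2,3))
  also have "\<dots> = (\<lambda>u. act' u (F x)) ` \<psi> ` torus"
    by (simp add: image_image)
  finally show ?thesis
    by (simp add: torus_aut_image[OF assms(1)] orbit_def)
qed

text \<open>Points of the orbit space are the orbits themselves, so the induced map is literally
  \<open>image F\<close>. Stabilizers are carried over by \<open>\<psi>\<close>, which preserves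
  triviality and hence the singular part.\<close>

lemma equivariant_imp_stratified_homeo:
  fixes X :: "'a topology" and act :: "complex ^ 'm \<Rightarrow> 'a \<Rightarrow> 'a"
    and X' :: "'b topology" and act' :: "complex ^ 'm \<Rightarrow> 'b \<Rightarrow> 'b"
  assumes "graph_torus_space X act" "graph_torus_space X' act'"
    and F: "homeomorphic_map X X' F" and \<psi>: "torus_aut \<psi>"
    and equiv: "\<forall>t\<in>torus. \<forall>x\<in>topspace X. F (act t x) = act' (\<psi> t) (F x)"
  shows "stratified_homeo X act X' act' (image F)"
    and "\<forall>S\<in>strata X act. \<psi> ` char_fun X act S = char_fun X' act' (image F ` S)"
proof -
  interpret X: graph_torus_space X act by fact
  interpret X': graph_torus_space X' act' by fact
  let ?Q = "orbit_space X act" and ?Q' = "orbit_space X' act'"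
  let ?Z = "orbit_space_Q0 X act" and ?Z' = "orbit_space_Q0 X' act'"
  obtain G where "homeomorphic_maps X X' F G"
    using F homeomorphic_map_maps by blast
  then have Fcont: "continuous_map X X' F" and Gcont: "continuous_map X' X G"
    and GF: "\<And>x. x \<in> topspace X \<Longrightarrow> G (F x) = x" and FG: "\<And>y. y \<in> topspace X' \<Longrightarrow> F (G y) = y"
    unfolding homeomorphic_maps_def by auto
  have Fin: "F x \<in> topspace X'" if "x \<in> topspace X" for x
    using continuous_map_image_subset_topspace[OF Fcont] that by (simp add: image_subset_iff)
  have Gin: "G y \<in> topspace X" if "y \<in> topspace X'" for y
    using continuous_map_image_subset_topspace[OF Gcont] that by (simp add: image_subset_iff)
  have Forb: "F ` orbit act x = orbit act' (F x)" if "x \<in> topspace X" for x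
    by (rule orbit_image[where X = X, OF \<psi> that]) (simp add: equiv)
  have GFim: "G ` F ` A = A" if "A \<subseteq> topspace X" for A
    using GF that by (force simp: image_image)
  have FGim: "F ` G ` A = A" if "A \<subseteq> topspace X'" for A
    using FG that by (force simp: image_image)
  have Gorb: "G ` orbit act' y = orbit act (G y)" if "y \<in> topspace X'" for y
    using Forb[OF Gin[OF that]] FG[OF that] GFim[OF X.orbit_subset[OF Gin[OF that]]] by simp
  have stab: "stabilizer X' act' (F x) = \<psi> ` stabilizer X act x" if x: "x \<in> topspace X" for x
  proof
    show "stabilizer X' act' (F x) \<subseteq> \<psi> ` stabilizer X act x"
    proof
      fix u assume u: "u \<in> stabilizer X' act' (F x)"
      then obtain t where t: "t \<in> torus" "u = \<psi> t"
        using torus_aut_surj[OF \<psi>, of u] by (auto simp: stabilizer_def)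
      then have "F (act t x) = F x"
        using u equiv x by (simp add: stabilizer_def)
      then have "act t x = x"
        using GF[OF x] GF[OF X.act_in[OF t(1) x]] by simp
      then show "u \<in> \<psi> ` stabilizer X act x"
        using t by (simp add: stabilizer_def)
    qed
    show "\<psi> ` stabilizer X act x \<subseteq> stabilizer X' act' (F x)"
    proof
      fix u assume "u \<in> \<psi> ` stabilizer X act x"
      then obtain t where "t \<in> torus" "act t x = x" "u = \<psi> t"
        by (auto simp: stabilizer_def)
      then show "u \<in> stabilizer X' act' (F x)"
        using equiv x torus_aut_in[OF \<psi>] by (metis (mono_tags, lifting) stabilizer_def mem_Collect_eq)
    qed
  qed
  have "continuous_map X ?Q' (image F \<circ> orbit act)"
  proof (rule continuous_map_eq[OF continuous_map_compose[OF Fcont quotient_imp_continuous_map[OF quotient_map_orbit]]])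
    show "(orbit act' \<circ> F) x = (image F \<circ> orbit act) x" if "x \<in> topspace X" for x
      using Forb[OF that] by simp
  qed
  then have cont: "continuous_map ?Q ?Q' (image F)"
    by (rule continuous_compose_quotient_map[OF quotient_map_orbit])
  have "continuous_map X' ?Q (image G \<circ> orbit act')"
  proof (rule continuous_map_eq[OF continuous_map_compose[OF Gcont quotient_imp_continuous_map[OF quotient_map_orbit]]])
    show "(orbit act \<circ> G) x = (image G \<circ> orbit act') x" if "x \<in> topspace X'" for x
      using Gorb[OF that] by simp
  qed
  then have cont': "continuous_map ?Q' ?Q (image G)"
    by (rule continuous_compose_quotient_map[OF quotient_map_orbit])
  have "homeomorphic_maps ?Q ?Q' (image F) (image G)"
    unfolding homeomorphic_maps_def
  proof (intro conjI ballI cont cont')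
    fix q assume "q \<in> topspace ?Q"
    then obtain x where "x \<in> topspace X" "q = orbit act x"
      unfolding topspace_orbit_space by (elim imageE)
    then show "G ` F ` q = q"
      using GFim X.orbit_subset by simp
  next
    fix q assume "q \<in> topspace ?Q'"
    then obtain x where "x \<in> topspace X'" "q = orbit act' x"
      unfolding topspace_orbit_space by (elim imageE)
    then show "F ` G ` q = q"
      using FGim X'.orbit_subset by simp
  qed
  then have homeo: "homeomorphic_map ?Q ?Q' (image F)"
    using homeomorphic_map_maps by blast
  have one: "\<psi> ` H = {1} \<longleftrightarrow> H = {1}" if "H \<subseteq> torus" for H
  proof
    assume H: "\<psi> ` H = {1}"
    have "h = 1" if "h \<in> H" for h
      using torus_aut_eq_one[OF \<psi>, of h] imageI[OF that, of \<psi>] that \<open>H \<subseteq> torus\<close> unfolding H by blast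
    moreover have "H \<noteq> {}"
      using H by (metis image_empty insert_not_empty)
    ultimately show "H = {1}" by blast
  qed (simp add: torus_aut_one[OF \<psi>])
  have sing: "F x \<in> sing_part X' act' \<longleftrightarrow> x \<in> sing_part X act" if "x \<in> topspace X" for x
    using stab[OF that] Fin[OF that] that one[of "stabilizer X act x"]
    by (auto simp: sing_part_def stabilizer_def)
  \<comment> \<open>An inclusion would suffice for the filtration clause of
    \<open>stratified_homeo\<close>; equality is proved so that complements correspond as well. Then
    \<open>image F\<close> restricts to homeomorphisms of both pieces and matches their components,
    the strata.\<close>
  have Zim: "image F ` ?Z = ?Z'"
  proof
    show "image F ` ?Z \<subseteq> ?Z'"
    proof
      fix q assume "q \<in> image F ` ?Z"
      then obtain x where x: "x \<in> sing_part X act" "q = F ` orbit act x"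
        unfolding orbit_space_Q0_def by blast
      then have "q = orbit act' (F x)" "F x \<in> sing_part X' act'"
        using X.sing_part_subset Forb[of x] sing[of x] by auto
      then show "q \<in> ?Z'"
        unfolding orbit_space_Q0_def by (rule image_eqI)
    qed
    show "?Z' \<subseteq> image F ` ?Z"
    proof
      fix q assume "q \<in> ?Z'"
      then obtain y where y: "y \<in> sing_part X' act'" "q = orbit act' y"
        unfolding orbit_space_Q0_def by blast
      then have "y \<in> topspace X'"
        using X'.sing_part_subset by blast
      then have "q = F ` orbit act (G y)" "G y \<in> sing_part X act"
        using y Forb[of "G y"] sing[of "G y"] Gin FG by auto
      then show "q \<in> image F ` ?Z"
        unfolding orbit_space_Q0_def by blast
    qed
  qed
  have Qim: "image F ` topspace ?Q = topspace ?Q'"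
    using homeomorphic_imp_surjective_map[OF homeo] .
  have "image F ` (topspace ?Q - ?Z) = topspace ?Q' - ?Z'"
    using inj_on_image_set_diff[OF homeomorphic_imp_injective_map[OF homeo], of "topspace ?Q" ?Z]
      X.orbit_space_Q0_subset Qim Zim by auto
  then have "homeomorphic_map (subtopology ?Q (topspace ?Q - ?Z)) (subtopology ?Q' (topspace ?Q' - ?Z')) (image F)"
    by (intro homeomorphic_map_subtopologies[OF homeo]) (simp add: Int_absorb1)
  moreover have "homeomorphic_map (subtopology ?Q ?Z) (subtopology ?Q' ?Z') (image F)"
    using Zim X.orbit_space_Q0_subset X'.orbit_space_Q0_subset
    by (intro homeomorphic_map_subtopologies[OF homeo]) (simp add: Int_absorb1)
  ultimately have strata': "strata X' act' = image (image F) ` strata X act"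
    unfolding strata_def image_Un by (metis homeomorphic_map_connected_components_of)
  show "stratified_homeo X act X' act' (image F)"
    unfolding stratified_homeo_def using homeo Zim strata' by simp
  show "\<forall>S\<in>strata X act. \<psi> ` char_fun X act S = char_fun X' act' (image F ` S)"
  proof
    fix S assume S: "S \<in> strata X act"
    then obtain x where x: "x \<in> topspace X" "orbit act x \<in> S"
      by (rule X.stratum_nonempty)
    have "image F ` S \<in> strata X' act'"
      using strata' S by simp
    moreover have "orbit act' (F x) \<in> image F ` S"
      using x Forb by (metis imageI)
    ultimately show "\<psi> ` char_fun X act S = char_fun X' act' (image F ` S)"
      using X.char_fun_eq_stabilizer[OF S x] X'.char_fun_eq_stabilizer[OF _ Fin[OF x(1)]] stab[OF x(1)] by simp
  qed
qed

theorem mainTheorem6: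
  fixes X :: "'a topology" and act :: "complex ^ 'm \<Rightarrow> 'a \<Rightarrow> 'a"
    and X' :: "'b topology" and act' :: "complex ^ 'm \<Rightarrow> 'b \<Rightarrow> 'b"
  assumes "locally_standard_over_graph X act"
    and "locally_standard_over_graph X' act'"
  shows "(char_data_iso X act X' act' \<longleftrightarrow> equivariant_homeomorphic X act X' act') \<and>
         (char_data_weak_iso X act X' act' \<longleftrightarrow> weakly_equivariant_homeomorphic X act X' act')"
proof -
  have G: "graph_torus_space X act" "graph_torus_space X' act'"
    using assms by (simp_all add: graph_torus_space_def)
  \<comment> \<open>Both equivalences are instances of these two lemmas; the strict one takes the
    identity for \<open>\<psi>\<close>.\<close>
  note to_equivariant = stratified_homeo_imp_equivariant[OF G]
    and to_stratified = equivariant_imp_stratified_homeo[OF G]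
  have "equivariant_homeomorphic X act X' act'" if "char_data_iso X act X' act'"
    using that to_equivariant[OF _ torus_aut_id]
    unfolding char_data_iso_def equivariant_homeomorphic_def by (elim exE conjE) simp
  moreover have "char_data_iso X act X' act'" if asm: "equivariant_homeomorphic X act X' act'"
  proof -
    obtain F where F: "homeomorphic_map X X' F" "\<forall>t\<in>torus. \<forall>x\<in>topspace X. F (act t x) = act' t (F x)"
      using asm unfolding equivariant_homeomorphic_def by (elim exE conjE)
    show ?thesis
      unfolding char_data_iso_def
      using to_stratified[OF F(1) torus_aut_id F(2)] by (intro exI[of _ "image F"]) simp
  qed
  moreover have "weakly_equivariant_homeomorphic X act X' act'" if asm: "char_data_weak_iso X act X' act'"
  proof -
    obtain f \<psi> where f: "stratified_homeo X act X' act' f" and \<psi>: "torus_aut \<psi>"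
      and "\<forall>S\<in>strata X act. \<psi> ` char_fun X act S = char_fun X' act' (f ` S)"
      using asm unfolding char_data_weak_iso_def by (elim exE conjE)
    from to_equivariant[OF this] show ?thesis
      unfolding weakly_equivariant_homeomorphic_def using \<psi> by (elim exE conjE) (intro exI conjI)
  qed
  moreover have "char_data_weak_iso X act X' act'" if asm: "weakly_equivariant_homeomorphic X act X' act'"
  proof -
    obtain F \<psi> where F: "homeomorphic_map X X' F" and \<psi>: "torus_aut \<psi>"
      and e: "\<forall>t\<in>torus. \<forall>x\<in>topspace X. F (act t x) = act' (\<psi> t) (F x)"
      using asm unfolding weakly_equivariant_homeomorphic_def by (elim exE conjE)
    show ?thesis
      unfolding char_data_weak_iso_def
      using to_stratified[OF F \<psi> e] \<psi> by (intro exI[of _ "image F"] exI[of _ \<psi>] conjI)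
  qed
  ultimately show ?thesis by (intro conjI iffI)
qed

end
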